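(* Let $f,g$ be randomly chosen parabolic elements of $\mathcal F$ (chosen independently). Then the probability that $\langle f,g\rangle$ is discrete is at least $\frac{1}{6}$.
   Context: $\mathbb S$ is the unit circle in $\mathbb C$. $\mathcal F$ is the group of matrices $A=\pm\begin{pmatrix} a & c\\ \bar c & \bar a\end{pmatrix}\in PSL(2,\mathbb C)$ with $a,c\in\mathbb C$, $|a|^2-|c|^2=1$, identified with the group of Möbius transformations $f(z)=\frac{az+c}{\bar c z+\bar a}$ preserving $\mathbb S$ and the unit disk. For $c\neq 0$ the isometric disks of $f$ are the disks $\{|z+\bar a/\bar c|<1/|c|\}$ and $\{|z-a/\bar c|<1/|c|\}$; each meets $\mathbb S$ in an arc of the same length $\ell\in(0,\pi)$, where $\sin(\ell/2)=1/|a|$. An element $f\ne \mathrm{id}$ is parabolic if $\Re(a)=\pm1$; then its two isometric disks are tangent at the fixed point $p\in\mathbb S$ of $f$, so the two arcs are adjacent, sharing the endpoint $p$. Conversely, a point $p\in\mathbb S$ and $\ell\in(0,\pi)$ determine a parabolic $f\in\mathcal F$, unique up to replacing $f$ by $f^{-1}$, whose isometric arcs are the two arcs of length $\ell$ with common endpoint $p$. A randomly chosen parabolic element is one for which $p$ is uniformly distributed on $\mathbb S$ and, independently, $\ell$ is uniformly distributed in $[0,\pi]$ (so the union of the two adjacent arcs is an arc of length $2\ell$ uniformly distributed in $[0,2\pi]$ with uniformly distributed midpoint $p$); the choice between $f$ and $f^{-1}$ does not affect the group generated. *)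

theory Defs
  imports "HOL-Probability.Probability" "HOL-Algebra.Coset" "HOL-Algebra.Generated_Groups"
begin

definition SL2C :: "(complex^2^2) monoid" where
  "SL2C = \<lparr>carrier = {A. det A = 1}, mult = (**), one = mat 1\<rparr>"

definition PSL2C :: "(complex^2^2) set monoid" where
  "PSL2C = SL2C Mod {mat 1, - mat 1}"

definition psl_proj :: "complex^2^2 \<Rightarrow> (complex^2^2) set" where
  "psl_proj A = {mat 1, - mat 1} #>\<^bsub>SL2C\<^esub> A"

lemma group_SL2C: "group SL2C"
proof (rule groupI)
  fix A assume "A \<in> carrier SL2C"
  then have d: "det A = 1" by (simp add: SL2C_def)
  then have "invertible A" by (simp add: invertible_det_nz)
  then obtain B where B: "A ** B = mat 1" "B ** A = mat 1"
    by (auto simp: invertible_def)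
  then have "det B = 1" using d det_mul[of B A] by (simp add: det_I)
  with B show "\<exists>B\<in>carrier SL2C. B \<otimes>\<^bsub>SL2C\<^esub> A = \<one>\<^bsub>SL2C\<^esub>"
    by (auto simp: SL2C_def)
qed (auto simp: SL2C_def det_mul det_I matrix_mul_assoc)

lemma matrix_mult_minus2:
  fixes A B :: "complex^2^2"
  shows "(- A) ** B = - (A ** B)" "A ** (- B) = - (A ** B)"
  by (simp_all add: vec_eq_iff matrix_matrix_mult_def sum_negf)

lemma det_minus2: "det (- A) = det (A :: complex^2^2)"
  by (simp add: det_2)

lemma psl_proj_eq: "psl_proj A = {A, - A}"
  by (auto simp: psl_proj_def r_coset_def SL2C_def matrix_mult_minus2)

lemma normal_center: "{mat 1, - mat 1} \<lhd> SL2C"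
proof -
  interpret group SL2C by (rule group_SL2C)
  have "subgroup {mat 1, - mat 1} SL2C"
  proof (rule subgroupI)
    fix A assume A: "A \<in> {mat 1, - mat 1 :: complex^2^2}"
    then have "A \<otimes>\<^bsub>SL2C\<^esub> A = \<one>\<^bsub>SL2C\<^esub>" "A \<in> carrier SL2C"
      by (auto simp: SL2C_def matrix_mult_minus2 det_minus2 det_I)
    then show "inv\<^bsub>SL2C\<^esub> A \<in> {mat 1, - mat 1}"
      using A inv_equality by metis
  qed (auto simp: SL2C_def matrix_mult_minus2 det_minus2 det_I)
  then show ?thesis
    by (rule normalI) (auto simp: r_coset_def l_coset_def SL2C_def matrix_mult_minus2)
qed

lemma group_PSL2C: "group PSL2C"
  unfolding PSL2C_def by (rule normal.factorgroup_is_group[OF normal_center])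

lemma carrier_PSL2C: "carrier PSL2C = psl_proj ` carrier SL2C"
  by (simp add: PSL2C_def carrier_FactGroup psl_proj_def[abs_def])

text \<open>The quotient topology of the subspace topology on \<open>SL(2,\<complex>) \<subseteq> \<complex>\<^sup>4\<close>.\<close>

definition PSL2C_topology :: "(complex^2^2) set topology" where
  "PSL2C_topology = topology (\<lambda>U. U \<subseteq> carrier PSL2C \<and>
     openin (top_of_set (carrier SL2C)) {A \<in> carrier SL2C. psl_proj A \<in> U})"

lemma openin_PSL2C_topology:
  "openin PSL2C_topology U \<longleftrightarrow> U \<subseteq> carrier PSL2C \<and>
     openin (top_of_set (carrier SL2C)) {A \<in> carrier SL2C. psl_proj A \<in> U}"
proof -
  let ?P = "\<lambda>U. {A \<in> carrier SL2C. psl_proj A \<in> U}"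
  have "?P (S \<inter> T) = ?P S \<inter> ?P T" for S T by auto
  moreover have "?P (\<Union>K) = \<Union>(?P ` K)" for K by auto
  ultimately have "istopology (\<lambda>U. U \<subseteq> carrier PSL2C \<and>
      openin (top_of_set (carrier SL2C)) (?P U))"
    unfolding istopology_def by (auto simp del: openin_subtopology)
  then show ?thesis unfolding PSL2C_topology_def by (simp add: topology_inverse')
qed

lemma topspace_PSL2C_topology: "topspace PSL2C_topology = carrier PSL2C"
proof -
  have "{A \<in> carrier SL2C. psl_proj A \<in> carrier PSL2C} = carrier SL2C"
    by (auto simp: carrier_PSL2C)
  then have "openin PSL2C_topology (carrier PSL2C)"
    by (simp add: openin_PSL2C_topology)
  then show ?thesis
    by (metis openin_PSL2C_topology openin_subset openin_topspace subset_antisym)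
qed

lemma quotient_map_psl_proj:
  "quotient_map (top_of_set (carrier SL2C)) PSL2C_topology psl_proj"
  by (auto simp: quotient_map_def topspace_PSL2C_topology carrier_PSL2C openin_PSL2C_topology)

definition discrete_in_PSL2C :: "(complex^2^2) set set \<Rightarrow> bool" where
  "discrete_in_PSL2C H \<longleftrightarrow> subtopology PSL2C_topology H = discrete_topology H"

definition disk_elem :: "complex \<Rightarrow> complex \<Rightarrow> (complex^2^2) set" where
  "disk_elem a c = psl_proj (vector [vector [a, c], vector [cnj c, cnj a]])"

definition disk_group :: "(complex^2^2) set set" where
  "disk_group = {disk_elem a c | a c. (cmod a)\<^sup>2 - (cmod c)\<^sup>2 = 1}"

definition parabolic :: "(complex^2^2) set \<Rightarrow> bool" where
  "parabolic f \<longleftrightarrow> f \<noteq> \<one>\<^bsub>PSL2C\<^esub> \<and>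
     (\<exists>a c. (cmod a)\<^sup>2 - (cmod c)\<^sup>2 = 1 \<and> f = disk_elem a c \<and> (Re a = 1 \<or> Re a = - 1))"

text \<open>The traces on the unit circle of the two isometric disks; they do not depend on
  which of the two matrices \<open>(a, c)\<close>, \<open>(- a, - c)\<close> represents \<open>f\<close>.\<close>

definition isometric_arcs :: "(complex^2^2) set \<Rightarrow> complex set set" where
  "isometric_arcs f = (\<Union>(a, c) \<in> {(a, c). (cmod a)\<^sup>2 - (cmod c)\<^sup>2 = 1 \<and> c \<noteq> 0 \<and> f = disk_elem a c}.
     {ball (- cnj a / cnj c) (1 / cmod c) \<inter> sphere 0 1,
      ball (a / cnj c) (1 / cmod c) \<inter> sphere 0 1})"

text \<open>\<open>f\<close> is one of the two mutually inverse parabolic elements determined by \<open>p\<close> and \<open>l\<close>: its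
  isometric arcs are the two (open) arcs of length \<open>l\<close> with common endpoint \<open>p\<close>.\<close>

definition parabolic_with :: "complex \<Rightarrow> real \<Rightarrow> (complex^2^2) set \<Rightarrow> bool" where
  "parabolic_with p l f \<longleftrightarrow> p \<in> sphere 0 1 \<and> 0 < l \<and> l < pi \<and> f \<in> disk_group \<and> parabolic f \<and>
     isometric_arcs f = {(\<lambda>t. p * cis t) ` {0<..<l}, (\<lambda>t. p * cis (- t)) ` {0<..<l}}"

definition uniform_circle :: "complex measure" where
  "uniform_circle = distr (uniform_measure lborel {0..2 * pi}) borel cis"

text \<open>The choice between the two elements determined by \<open>p \<omega>\<close> and \<open>l \<omega>\<close> is left
  completely arbitrary; it need not even be measurable.\<close>

definition random_parabolic ::
  "'w measure \<Rightarrow> ('w \<Rightarrow> complex) \<Rightarrow> ('w \<Rightarrow> real) \<Rightarrow> ('w \<Rightarrow> (complex^2^2) set) \<Rightarrow> bool" where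
  "random_parabolic M p l f \<longleftrightarrow>
     p \<in> borel_measurable M \<and> distr M borel p = uniform_circle \<and>
     l \<in> borel_measurable M \<and> distr M borel l = uniform_measure lborel {0..pi} \<and>
     prob_space.indep_var M borel p borel l \<and>
     (\<forall>\<omega>\<in>space M. parabolic_with (p \<omega>) (l \<omega>) (f \<omega>))"

end

theory Submission
  imports Defs
begin

text \<open>Ping-pong shows that \<open>f\<close> and \<open>g\<close> generate a discrete group whenever the union of the two isometric
arcs of \<open>f\<close> is disjoint from that of \<open>g\<close>, and two random arcs of the given distribution are disjoint
with probability \<open>1 / 6\<close>.

Let \<open>f\<close> fix \<open>p\<close> and have isometric arcs of length \<open>l\<close>. In the coordinate \<open>u = cot (\<theta> / 2)\<close> on the circle,
where \<open>\<theta>\<close> is the angle from \<open>p\<close>, the element \<open>f\<close> is the translation by \<open>\<plusminus> 2 cot (l / 2)\<close>. The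
two isometric arcs and \<open>p\<close> form the arc of angular radius \<open>l\<close> about \<open>p\<close>, whose exterior is the
interval \<open>\<bar>u\<bar> < cot (l / 2)\<close>. So every nontrivial power of \<open>f\<close> moves this exterior into the arc
(\<open>para_ping_pong\<close>; the matrix of \<open>f\<close> is found in \<open>parabolic_with_para\<close>). If the arcs of \<open>f\<close> and \<open>g\<close> are disjoint, a nontrivial reduced word
moves any common exterior point into one of them (\<open>ping_pong\<close>). An element close to the identity
keeps such a point outside both arcs, so the identity is isolated in the group, which is discreteness
(\<open>discrete_psl_image_iff\<close>, \<open>discrete_of_disjoint_arcs\<close>).

The arcs have total length \<open>2 (l + k)\<close>. They are disjoint when \<open>l + k < pi\<close> and the midpoints are more
than \<open>l + k\<close> apart, which for given \<open>l\<close> and \<open>k\<close> has probability \<open>1 - (l + k) / pi\<close>. With \<open>x = l / pi\<close>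
and \<open>y = k / pi\<close> uniform on the unit interval, the integral of \<open>1 - x - y\<close> over \<open>x + y < 1\<close> is \<open>1 / 6\<close>
(\<open>emeasure_disjoint_arcs\<close>).

The choice between \<open>f\<close> and its inverse may be nonmeasurable, but the group does not depend on it, and
its discreteness is expressed by countably many conditions on words that are continuous in \<open>p\<close>, \<open>l\<close>, \<open>q\<close>, \<open>k\<close>
(\<open>measurable_discreteness\<close>). Hence the event in the theorem is measurable, and monotonicity of
the measure applies.\<close>

section \<open>Discreteness in terms of matrices\<close>

lemma vec2_eq_iff: "v = w \<longleftrightarrow> v $ 1 = w $ 1 \<and> v $ 2 = w $ 2" for v w :: "'a^2"
  by (simp add: vec_eq_iff forall_2)

lemma continuous_on_matrix_mult:
  fixes f :: "'a::topological_space \<Rightarrow> 'b::real_normed_algebra_1^'n^'m"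
    and g :: "'a \<Rightarrow> 'b^'k^'n"
  assumes "continuous_on S f" "continuous_on S g"
  shows "continuous_on S (\<lambda>x. f x ** g x)"
proof -
  have "continuous_on S (\<lambda>x. f x $ i $ j)" for i j
    by (intro continuous_on_component assms)
  moreover have "continuous_on S (\<lambda>x. g x $ i $ j)" for i j
    by (intro continuous_on_component assms)
  ultimately show ?thesis
    unfolding matrix_matrix_mult_def
    by (intro continuous_on_vec_lambda continuous_on_sum continuous_on_mult) auto
qed

lemma psl_proj_eq_iff: "psl_proj A = psl_proj B \<longleftrightarrow> A = B \<or> A = - B"
  by (auto simp: psl_proj_eq doubleton_eq_iff)

lemma psl_proj_mult:
  assumes "A \<in> carrier SL2C" "B \<in> carrier SL2C"
  shows "psl_proj A \<otimes>\<^bsub>PSL2C\<^esub> psl_proj B = psl_proj (A ** B)"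
  using normal.rcos_sum[OF normal_center, of A B] assms
  by (simp add: PSL2C_def FactGroup_def psl_proj_def SL2C_def)

lemma one_PSL2C: "\<one>\<^bsub>PSL2C\<^esub> = psl_proj (mat 1)"
  by (auto simp: PSL2C_def FactGroup_def psl_proj_eq)

lemma SL2C_inv_cancel:
  assumes "A \<in> carrier SL2C"
  shows "A ** inv\<^bsub>SL2C\<^esub> A = mat 1" "inv\<^bsub>SL2C\<^esub> A ** A = mat 1"
proof -
  interpret group SL2C by (rule group_SL2C)
  show "A ** inv\<^bsub>SL2C\<^esub> A = mat 1" "inv\<^bsub>SL2C\<^esub> A ** A = mat 1"
    using r_inv[OF assms] l_inv[OF assms] by (simp_all add: SL2C_def)
qed

lemma psl_proj_hom: "psl_proj \<in> hom SL2C PSL2C"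
proof (rule homI)
  show "psl_proj A \<in> carrier PSL2C" if "A \<in> carrier SL2C" for A
    using that by (simp add: carrier_PSL2C)
  show "psl_proj (A \<otimes>\<^bsub>SL2C\<^esub> B) = psl_proj A \<otimes>\<^bsub>PSL2C\<^esub> psl_proj B"
    if "A \<in> carrier SL2C" "B \<in> carrier SL2C" for A B
    unfolding psl_proj_mult[OF that] by (simp add: SL2C_def)
qed

lemma psl_proj_group_hom: "group_hom SL2C PSL2C psl_proj"
  by (simp add: group_hom_def group_hom_axioms_def group_SL2C group_PSL2C psl_proj_hom)

text \<open>Left translations are homeomorphisms, so a group is discrete as soon as its identity is isolated;
and a matrix of \<open>SL(2,\<complex>)\<close> represents a point near the identity of the quotient exactly when it is
near one of \<open>\<plusminus> 1\<close>. The resulting condition quantifies over the group elements one by one, which is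
what makes discreteness a measurable condition on the generators later.\<close>

lemma discrete_psl_image_iff:
  assumes G: "subgroup \<Gamma> SL2C"
  shows "discrete_in_PSL2C (psl_proj ` \<Gamma>) \<longleftrightarrow>
    (\<exists>e>0. \<forall>A\<in>\<Gamma>. A = mat 1 \<or> A = - mat 1 \<or> e \<le> dist A (mat 1) \<and> e \<le> dist (- A) (mat 1))"
    (is "?L \<longleftrightarrow> ?R")
proof
  have sub: "\<Gamma> \<subseteq> carrier SL2C" by (rule subgroup.subset[OF G])
  have one: "mat 1 \<in> \<Gamma>" using subgroup.one_closed[OF G] by (simp add: SL2C_def)
  have Hsub: "psl_proj ` \<Gamma> \<subseteq> carrier PSL2C" using sub by (auto simp: carrier_PSL2C)
  {
    assume L: ?L
    have "openin (subtopology PSL2C_topology (psl_proj ` \<Gamma>)) {psl_proj (mat 1)}"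
      using L one unfolding discrete_in_PSL2C_def by (simp only: openin_discrete_topology) blast
    then obtain U where U: "openin PSL2C_topology U" "{psl_proj (mat 1)} = U \<inter> psl_proj ` \<Gamma>"
      unfolding openin_subtopology by blast
    from U(1) obtain T where T: "open T" "{A \<in> carrier SL2C. psl_proj A \<in> U} = carrier SL2C \<inter> T"
      unfolding openin_PSL2C_topology openin_open by blast
    have "mat 1 \<in> T" using U(2) T(2) sub one by blast
    then obtain e where e: "e > 0" "\<And>B. dist B (mat 1) < e \<Longrightarrow> B \<in> T"
      using T(1) unfolding open_dist by blast
    have "A = mat 1 \<or> A = - mat 1"
      if "A \<in> \<Gamma>" "dist A (mat 1) < e \<or> dist (- A) (mat 1) < e" for A
    proof -
      have c: "A \<in> carrier SL2C" "- A \<in> carrier SL2C" "psl_proj (- A) = psl_proj A"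
        using that(1) sub by (auto simp: SL2C_def det_minus2 psl_proj_eq)
      have pre: "psl_proj B \<in> U" if "B \<in> carrier SL2C" "B \<in> T" for B
        using that T(2) by blast
      have "psl_proj A \<in> U" using that(2)
      proof
        assume "dist A (mat 1) < e" then show ?thesis by (intro pre c e(2))
      next
        assume "dist (- A) (mat 1) < e"
        then have "psl_proj (- A) \<in> U" by (intro pre c e(2))
        then show ?thesis by (simp only: c)
      qed
      then have "psl_proj A = psl_proj (mat 1)" using U(2) that(1) by blast
      then show ?thesis by (simp add: psl_proj_eq_iff)
    qed
    then have "\<forall>A\<in>\<Gamma>. A = mat 1 \<or> A = - mat 1 \<or> e \<le> dist A (mat 1) \<and> e \<le> dist (- A) (mat 1)"
      unfolding linorder_not_less[symmetric] by blast
    then show ?R using e(1) by blast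
  }
  {
    assume ?R
    then obtain e where e: "e > 0" and sep: "\<And>A. A \<in> \<Gamma> \<Longrightarrow> dist A (mat 1) < e \<or> dist (- A) (mat 1) < e
      \<Longrightarrow> A = mat 1 \<or> A = - mat 1" unfolding linorder_not_less[symmetric] by blast
    have "openin (subtopology PSL2C_topology (psl_proj ` \<Gamma>)) {psl_proj A}" if A: "A \<in> \<Gamma>" for A
    proof -
      let ?J = "inv\<^bsub>SL2C\<^esub> A"
      have AJ: "A ** ?J = mat 1" "?J ** A = mat 1" using SL2C_inv_cancel A sub by blast+
      have J: "?J \<in> \<Gamma>" using G A by (rule subgroup.m_inv_closed)
      \<comment> \<open>the translate by \<open>A\<close> of the neighbourhood of \<open>\<plusminus> 1\<close> provided by the separation constant\<close>
      let ?V = "{B. dist (?J ** B) (mat 1) < e \<or> dist (- (?J ** B)) (mat 1) < e}"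
      have oV: "open ?V" by (intro open_Collect_disj open_Collect_less continuous_intros
            continuous_on_matrix_mult)
      have Vm: "- B \<in> ?V \<longleftrightarrow> B \<in> ?V" for B by (auto simp: matrix_mult_minus2)
      let ?U = "psl_proj ` (carrier SL2C \<inter> ?V)"
      have pre: "{B \<in> carrier SL2C. psl_proj B \<in> ?U} = carrier SL2C \<inter> ?V"
      proof (intro equalityI subsetI)
        fix B assume "B \<in> {B \<in> carrier SL2C. psl_proj B \<in> ?U}"
        then obtain C where C: "C \<in> ?V" "psl_proj B = psl_proj C" and B: "B \<in> carrier SL2C" by blast
        from C(2) have "B = C \<or> B = - C" by (simp only: psl_proj_eq_iff)
        then have "B \<in> ?V" by (elim disjE) (simp_all only: Vm C(1))
        then show "B \<in> carrier SL2C \<inter> ?V" using B by blast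
      qed blast
      have "openin PSL2C_topology ?U" unfolding openin_PSL2C_topology pre
        using oV by (auto simp: carrier_PSL2C openin_open)
      moreover have "?U \<inter> psl_proj ` \<Gamma> = {psl_proj A}"
      proof (intro equalityI subsetI)
        fix x assume "x \<in> ?U \<inter> psl_proj ` \<Gamma>"
        then obtain B where B: "B \<in> \<Gamma>" "x = psl_proj B" and "psl_proj B \<in> ?U" by auto
        then have "B \<in> ?V" using pre sub by blast
        then have V: "dist (?J ** B) (mat 1) < e \<or> dist (- (?J ** B)) (mat 1) < e" by simp
        have "?J ** B \<in> \<Gamma>" using subgroup.m_closed[OF G J B(1)] by (simp add: SL2C_def)
        then have "?J ** B = mat 1 \<or> ?J ** B = - mat 1" using sep V by blast
        then have "A ** (?J ** B) = A \<or> A ** (?J ** B) = - A" by (auto simp: matrix_mult_minus2)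
        then have "B = A \<or> B = - A" by (simp add: matrix_mul_assoc AJ)
        then show "x \<in> {psl_proj A}" using B(2) by (simp add: psl_proj_eq_iff)
      next
        fix x assume "x \<in> {psl_proj A}"
        moreover have "A \<in> ?V" using e by (simp add: AJ)
        ultimately show "x \<in> ?U \<inter> psl_proj ` \<Gamma>" using A sub by blast
      qed
      ultimately show ?thesis unfolding openin_subtopology by blast
    qed
    moreover have "topspace (subtopology PSL2C_topology (psl_proj ` \<Gamma>)) = psl_proj ` \<Gamma>"
      using Hsub by (simp add: topspace_subtopology topspace_PSL2C_topology Int_absorb1)
    ultimately have "discrete_topology (psl_proj ` \<Gamma>) = subtopology PSL2C_topology (psl_proj ` \<Gamma>)"
      unfolding discrete_topology_unique by blast
    then show ?L unfolding discrete_in_PSL2C_def by (rule sym)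
  }
qed

section \<open>Words in two cyclic groups and ping-pong\<close>

text \<open>A syllable \<open>(b, n)\<close> stands for the \<open>n\<close>-th power of the generator with label \<open>b\<close>. Formal words form a
countable set that does not depend on the generators, so that a random two-generator group can be
studied word by word.\<close>

primrec word :: "(bool \<Rightarrow> int \<Rightarrow> complex^2^2) \<Rightarrow> (bool \<times> int) list \<Rightarrow> complex^2^2" where
  "word P [] = mat 1"
| "word P (x # w) = P (fst x) (snd x) ** word P w"

fun reduced :: "(bool \<times> int) list \<Rightarrow> bool" where
  "reduced [] \<longleftrightarrow> True"
| "reduced [x] \<longleftrightarrow> snd x \<noteq> 0"
| "reduced (x # y # w) \<longleftrightarrow> snd x \<noteq> 0 \<and> fst x \<noteq> fst y \<and> reduced (y # w)"

locale two_cyclic =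
  fixes P :: "bool \<Rightarrow> int \<Rightarrow> complex^2^2"
  assumes add: "P b (m + n) = P b m ** P b n"
    and zero: "P b 0 = mat 1"
    and det: "det (P b n) = 1"
begin

lemma word_append: "word P (u @ w) = word P u ** word P w"
  by (induction u) (simp_all add: matrix_mul_assoc)

lemma word_inverse: "word P (rev (map (\<lambda>x. (fst x, - snd x)) w)) ** word P w = mat 1"
proof (induction w)
  case (Cons x w)
  let ?v = "word P (rev (map (\<lambda>x. (fst x, - snd x)) w))"
  have inverse: "P (fst x) (- snd x) ** P (fst x) (snd x) = mat 1"
    using add[of "fst x" "- snd x" "snd x"] zero by simp
  have "(?v ** P (fst x) (- snd x)) ** (P (fst x) (snd x) ** word P w)
      = ?v ** ((P (fst x) (- snd x) ** P (fst x) (snd x)) ** word P w)"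
    by (simp only: matrix_mul_assoc)
  also have "\<dots> = mat 1" using Cons.IH by (simp add: inverse)
  finally show ?case by (simp add: word_append)
qed simp

lemma det_word: "det (word P w) = 1"
  by (induction w) (simp_all add: det_mul det)

lemma subgroup_words: "subgroup (range (word P)) SL2C"
proof -
  interpret G: group SL2C by (rule group_SL2C)
  show ?thesis
  proof (rule G.subgroupI)
    show "range (word P) \<subseteq> carrier SL2C" by (auto simp: SL2C_def det_word)
    show "range (word P) \<noteq> {}" by blast
    fix A assume "A \<in> range (word P)"
    then obtain w where w: "A = word P w" by blast
    define B where "B = word P (rev (map (\<lambda>x. (fst x, - snd x)) w))"
    have "B \<otimes>\<^bsub>SL2C\<^esub> A = \<one>\<^bsub>SL2C\<^esub>" using word_inverse[of w] by (simp add: SL2C_def w B_def)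
    moreover have "A \<in> carrier SL2C" "B \<in> carrier SL2C" by (auto simp: SL2C_def w B_def det_word)
    ultimately have "inv\<^bsub>SL2C\<^esub> A = B" by (rule G.inv_equality)
    then show "inv\<^bsub>SL2C\<^esub> A \<in> range (word P)" by (simp add: B_def)
    fix C assume "C \<in> range (word P)"
    then show "A \<otimes>\<^bsub>SL2C\<^esub> C \<in> range (word P)"
      by (auto simp: SL2C_def w simp flip: word_append)
  qed
qed

text \<open>Either generator may be replaced by its inverse: this is the freedom that is left when a parabolic
element is only known through its isometric arcs.\<close>

lemma generate_eq_words:
  assumes f: "f \<in> {psl_proj (P True 1), psl_proj (P True (- 1))}"
    and g: "g \<in> {psl_proj (P False 1), psl_proj (P False (- 1))}"
  shows "generate PSL2C {f, g} = psl_proj ` range (word P)"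
proof
  interpret G: group PSL2C by (rule group_PSL2C)
  interpret h: group_hom SL2C PSL2C psl_proj by (rule psl_proj_group_hom)
  have c: "P b n \<in> carrier SL2C" for b n by (simp add: SL2C_def det)
  have pc: "psl_proj (P b n) \<in> carrier PSL2C" for b n using c by simp
  have "psl_proj (P b n) \<in> psl_proj ` range (word P)" for b n
    by (rule image_eqI[OF refl], rule range_eqI[of _ _ "[(b, n)]"]) simp
  then show "generate PSL2C {f, g} \<subseteq> psl_proj ` range (word P)"
    using f g by (intro G.generate_subgroup_incl h.subgroup_img_is_subgroup subgroup_words) auto
  have sub: "subgroup (generate PSL2C {f, g}) PSL2C"
    using f g pc by (intro G.generate_is_subgroup) auto
  have mult: "psl_proj (P b (m + n)) = psl_proj (P b m) \<otimes>\<^bsub>PSL2C\<^esub> psl_proj (P b n)" for b m n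
    by (simp add: add psl_proj_mult c)
  have inv: "inv\<^bsub>PSL2C\<^esub> psl_proj (P b n) = psl_proj (P b (- n))" for b n
    using mult[of b "- n" n] pc by (intro G.inv_equality) (simp_all add: zero one_PSL2C)
  have ex: "\<exists>n\<in>{1, -1}. psl_proj (P b n) \<in> generate PSL2C {f, g}" for b
    using f g by (cases b) (auto intro: generate.incl)
  have unit: "psl_proj (P b 1) \<in> generate PSL2C {f, g} \<and> psl_proj (P b (- 1)) \<in> generate PSL2C {f, g}" for b
    using ex[of b] subgroup.m_inv_closed[OF sub] inv by force
  have "psl_proj (P b n) \<in> generate PSL2C {f, g}" for b n
  proof (induction n rule: int_induct[of _ 0])
    case base
    show ?case using generate.one[of PSL2C "{f, g}"] by (simp add: zero one_PSL2C)
  next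
    case (step1 i)
    then show ?case using unit by (simp add: mult generate.eng)
  next
    case (step2 i)
    then show ?case using unit mult[of b i "- 1"] by (simp add: generate.eng)
  qed
  then have "psl_proj (word P w) \<in> generate PSL2C {f, g}" for w
  proof (induction w)
    case Nil
    show ?case using generate.one[of PSL2C "{f, g}"] by (simp add: one_PSL2C)
  next
    case (Cons x w)
    have "word P w \<in> carrier SL2C" by (simp add: SL2C_def det_word)
    then have "psl_proj (word P (x # w)) = psl_proj (P (fst x) (snd x)) \<otimes>\<^bsub>PSL2C\<^esub> psl_proj (word P w)"
      using c by (simp add: psl_proj_mult)
    then show ?case using Cons by (metis generate.eng)
  qed
  then show "psl_proj ` range (word P) \<subseteq> generate PSL2C {f, g}" by blast
qed

text \<open>A new syllable is either put in front of a reduced word, or merged with a first syllable of the same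
label, which disappears if the exponents cancel.\<close>

lemma word_eq_reduced: "\<exists>u. reduced u \<and> word P u = word P w"
proof (induction w)
  case Nil
  show ?case by (rule exI[of _ "[]"]) simp
next
  case (Cons x w)
  then obtain u where u: "reduced u" "word P u = word P w" by blast
  obtain b n where x: "x = (b, n)" by (cases x)
  consider "n = 0" | "n \<noteq> 0" "u = []" | c m u' where "n \<noteq> 0" "u = (c, m) # u'" "c \<noteq> b"
    | m u' where "u = (b, m) # u'" "n + m = 0" | m u' where "u = (b, m) # u'" "n + m \<noteq> 0"
  proof (cases u)
    case Nil
    then show ?thesis using that(1,2) by blast
  next
    case (Cons y u')
    obtain c m where "y = (c, m)" by (cases y)
    then show ?thesis using that Cons by (cases "c = b"; cases "n = 0"; cases "n + m = 0") auto
  qed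
  then show ?case
  proof cases
    case 1
    then show ?thesis using u by (auto simp: x zero)
  next
    case 2
    then show ?thesis using u by (intro exI[of _ "[(b, n)]"]) (simp add: x)
  next
    case (3 c m u')
    then show ?thesis using u by (intro exI[of _ "(b, n) # u"]) (simp add: x)
  next
    case (4 m u')
    have "word P w = P b m ** word P u'" using u(2) 4(1) by simp
    then have "word P (x # w) = P b (n + m) ** word P u'"
      unfolding add by (simp add: x matrix_mul_assoc)
    moreover have "reduced u'" using u(1) 4 by (cases u') auto
    ultimately show ?thesis using 4 by (auto simp: zero)
  next
    case (5 m u')
    have "word P w = P b m ** word P u'" using u(2) 5(1) by simp
    then have "word P (x # w) = P b (n + m) ** word P u'"
      unfolding add by (simp add: x matrix_mul_assoc)
    moreover have "reduced ((b, n + m) # u')" using u(1) 5 by (cases u') auto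
    ultimately show ?thesis by (intro exI[of _ "(b, n + m) # u'"]) simp
  qed
qed

text \<open>Nonzero powers of the generator \<open>b\<close> push \<open>Out b\<close> into \<open>In b\<close>, and \<open>In (\<not> b)\<close> lies in \<open>Out b\<close>. Reading
a reduced word from right to left, the image of \<open>v\<close> therefore jumps between the two sets \<open>In\<close> and ends
in the one that belongs to the leftmost syllable.\<close>

lemma ping_pong:
  assumes step: "\<And>b n v. n \<noteq> 0 \<Longrightarrow> v \<in> Out b \<Longrightarrow> P b n *v v \<in> In b"
    and sub: "\<And>b. In (\<not> b) \<subseteq> Out b"
    and v: "\<And>b. v \<in> Out b"
    and w: "word P w \<noteq> mat 1"
  shows "\<exists>b. word P w *v v \<in> In b"
proof -
  have "word P (x # u) *v v \<in> In (fst x)" if "reduced (x # u)" for x u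
    using that
  proof (induction u arbitrary: x)
    case Nil
    then show ?case using step v by simp
  next
    case (Cons y u)
    have "fst y = (\<not> fst x)" using Cons.prems by auto
    moreover have "word P (y # u) *v v \<in> In (fst y)" using Cons.prems by (intro Cons.IH) simp
    ultimately have "word P (y # u) *v v \<in> Out (fst x)" using sub[of "fst x"] by auto
    then have "P (fst x) (snd x) *v (word P (y # u) *v v) \<in> In (fst x)"
      using Cons.prems by (intro step) auto
    then show ?case by (simp add: matrix_vector_mul_assoc)
  qed
  moreover obtain u where "reduced u" "word P u = word P w" using word_eq_reduced by blast
  ultimately show ?thesis using w by (cases u) (auto, metis)
qed

end

section \<open>One-parameter groups of parabolic matrices\<close>

text \<open>For \<open>\<bar>p\<bar> = 1\<close> this is \<open>1 + s N\<close> with a nilpotent matrix \<open>N\<close> whose kernel is spanned by \<open>(p, 1)\<close>;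
hence \<open>s\<close> is an additive parameter, and \<open>p\<close> is the fixed point on the circle.\<close>

definition para :: "complex \<Rightarrow> real \<Rightarrow> complex^2^2" where
  "para p s = vector [vector [1 + \<i> * s, - (\<i> * s * p)], vector [\<i> * s * cnj p, 1 - \<i> * s]]"

lemma mult_cnj_unit: "cmod z = 1 \<Longrightarrow> z * cnj z = 1"
  by (simp add: complex_norm_square[symmetric])

lemma para_zero: "para p 0 = mat 1"
  by (simp add: vec2_eq_iff para_def mat_def)

lemma det_para:
  assumes "cmod p = 1"
  shows "det (para p s) = 1"
  using mult_cnj_unit[OF assms] i_squared unfolding det_2 para_def vector_2 by algebra

lemma para_add:
  assumes "cmod p = 1"
  shows "para p (s + t) = para p s ** para p t"
proof -
  have "p * cnj p = 1" by (rule mult_cnj_unit) fact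
  moreover note i_squared
  ultimately show ?thesis
    unfolding vec2_eq_iff para_def matrix_matrix_mult_def vec_lambda_beta vector_2 sum_2 of_real_add
    by algebra
qed

lemma para_mult_vec:
  assumes "cmod p = 1"
  shows "(para p s *v v) $ 1 = v $ 1 + \<i> * s * (v $ 1 - p * v $ 2)"
    and "(para p s *v v) $ 2 = v $ 2 + \<i> * s * cnj p * (v $ 1 - p * v $ 2)"
proof -
  note entries = para_def matrix_vector_mult_def vec_lambda_beta sum_2 vector_2
  show "(para p s *v v) $ 1 = v $ 1 + \<i> * s * (v $ 1 - p * v $ 2)"
    unfolding entries by algebra
  show "(para p s *v v) $ 2 = v $ 2 + \<i> * s * cnj p * (v $ 1 - p * v $ 2)"
    unfolding entries using mult_cnj_unit[OF assms] by algebra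
qed

lemma two_cyclic_para:
  assumes "\<And>b. cmod (c b) = 1"
  shows "two_cyclic (\<lambda>b n. para (c b) (of_int n * s b))"
proof
  fix b and m n :: int
  show "para (c b) (of_int (m + n) * s b) = para (c b) (of_int m * s b) ** para (c b) (of_int n * s b)"
    using para_add[OF assms] by (simp add: distrib_right)
qed (simp_all add: para_zero det_para assms)

text \<open>A vector with entries of equal nonzero modulus represents the point \<open>z = x / y\<close> of the unit circle, and
the open arc of angular radius \<open>l\<close> about \<open>p\<close> is \<open>cos l < Re (z * cnj p)\<close>. Homogeneous
coordinates avoid the division: \<open>arc_cone\<close> is the cone over this arc, and \<open>coarc_cone\<close> is the cone
over the complement of its closure.\<close>

definition arc_cone :: "complex \<Rightarrow> real \<Rightarrow> (complex^2) set" where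
  "arc_cone p l = {v. cmod (v $ 1) = cmod (v $ 2) \<and>
     (cmod (v $ 1))\<^sup>2 * cos l < Re (v $ 1 * cnj (p * v $ 2))}"

definition coarc_cone :: "complex \<Rightarrow> real \<Rightarrow> (complex^2) set" where
  "coarc_cone p l = {v. cmod (v $ 1) = cmod (v $ 2) \<and>
     Re (v $ 1 * cnj (p * v $ 2)) < (cmod (v $ 1))\<^sup>2 * cos l}"

lemma cmod_add_sq: "(cmod (u + w))\<^sup>2 = (cmod u)\<^sup>2 + (cmod w)\<^sup>2 + 2 * Re (u * cnj w)"
  unfolding cmod_power2 by (simp add: power2_eq_square algebra_simps)

lemma cot_half_sq:
  assumes "0 < l" "l < pi"
  shows "0 < cot (l / 2)" "(cot (l / 2))\<^sup>2 * (1 - cos l) = 1 + cos l"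
proof -
  have s: "0 < sin (l / 2)" "0 < cos (l / 2)" using assms by (auto intro!: sin_gt_zero cos_gt_zero)
  then show "0 < cot (l / 2)" by (simp add: cot_def)
  have "cos l = 1 - 2 * (sin (l / 2))\<^sup>2" "cos l = 2 * (cos (l / 2))\<^sup>2 - 1"
    using cos_double_sin[of "l / 2"] cos_double_cos[of "l / 2"] by simp_all
  then have "1 - cos l = 2 * (sin (l / 2))\<^sup>2" "1 + cos l = 2 * (cos (l / 2))\<^sup>2" by linarith+
  then show "(cot (l / 2))\<^sup>2 * (1 - cos l) = 1 + cos l"
    using s by (simp add: cot_def power_divide)
qed

text \<open>In the coordinates \<open>\<alpha> = x + p y\<close> and \<open>\<beta> = x - p y\<close> the quotient \<open>\<alpha> / \<beta>\<close> is, up to a factor \<open>\<i>\<close>, the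
cotangent of half the angle between \<open>z\<close> and \<open>p\<close>. This is the coordinate that sends \<open>p\<close> to infinity and
in which parabolic elements fixing \<open>p\<close> become translations.\<close>

lemma cone_via_cot:
  assumes p: "cmod p = 1" and l: "0 < l" "l < pi" and v: "cmod (v $ 1) = cmod (v $ 2)"
  shows "v \<in> arc_cone p l \<longleftrightarrow> cot (l / 2) * cmod (v $ 1 - p * v $ 2) < cmod (v $ 1 + p * v $ 2)"
    and "v \<in> coarc_cone p l \<longleftrightarrow> cmod (v $ 1 + p * v $ 2) < cot (l / 2) * cmod (v $ 1 - p * v $ 2)"
proof -
  define R r where "R = Re (v $ 1 * cnj (p * v $ 2))" and "r = (cmod (v $ 1))\<^sup>2"
  define A B where "A = (cmod (v $ 1 + p * v $ 2))\<^sup>2" and "B = (cmod (v $ 1 - p * v $ 2))\<^sup>2"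
  have A: "A = 2 * r + 2 * R"
    unfolding A_def cmod_add_sq R_def r_def by (simp add: norm_mult p v)
  have B: "B = 2 * r - 2 * R"
    unfolding B_def R_def r_def using cmod_add_sq[of "v $ 1" "- (p * v $ 2)"] by (simp add: norm_mult p v)
  note c = cot_half_sq[OF l]
  have pos: "0 < 1 - cos l" using cos_monotone_0_pi[of 0 l] l by simp
  \<comment> \<open>both cones are decided by the sign of this one quantity\<close>
  have e: "(1 - cos l) * (A - (cot (l / 2))\<^sup>2 * B) = 4 * (R - r * cos l)"
    using c(2) unfolding A B by algebra
  have sq: "(cot (l / 2) * cmod (v $ 1 - p * v $ 2))\<^sup>2 = (cot (l / 2))\<^sup>2 * B"
    by (simp add: B_def power_mult_distrib)
  have "r * cos l < R \<longleftrightarrow> 0 < (1 - cos l) * (A - (cot (l / 2))\<^sup>2 * B)" unfolding e by simp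
  also have "\<dots> \<longleftrightarrow> (cot (l / 2) * cmod (v $ 1 - p * v $ 2))\<^sup>2 < (cmod (v $ 1 + p * v $ 2))\<^sup>2"
    unfolding sq A_def[symmetric] using pos by (simp add: zero_less_mult_iff)
  also have "\<dots> \<longleftrightarrow> cot (l / 2) * cmod (v $ 1 - p * v $ 2) < cmod (v $ 1 + p * v $ 2)"
    using c(1) by (auto intro: power_strict_mono power_less_imp_less_base)
  finally show "v \<in> arc_cone p l \<longleftrightarrow> cot (l / 2) * cmod (v $ 1 - p * v $ 2) < cmod (v $ 1 + p * v $ 2)"
    by (simp add: arc_cone_def v R_def r_def)
  have "R < r * cos l \<longleftrightarrow> (1 - cos l) * (A - (cot (l / 2))\<^sup>2 * B) < 0" unfolding e by simp
  also have "\<dots> \<longleftrightarrow> (cmod (v $ 1 + p * v $ 2))\<^sup>2 < (cot (l / 2) * cmod (v $ 1 - p * v $ 2))\<^sup>2"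
    unfolding sq A_def[symmetric] using pos by (simp add: mult_less_0_iff)
  also have "\<dots> \<longleftrightarrow> cmod (v $ 1 + p * v $ 2) < cot (l / 2) * cmod (v $ 1 - p * v $ 2)"
    using c(1) by (auto intro: power_strict_mono power_less_imp_less_base)
  finally show "v \<in> coarc_cone p l \<longleftrightarrow> cmod (v $ 1 + p * v $ 2) < cot (l / 2) * cmod (v $ 1 - p * v $ 2)"
    by (simp add: coarc_cone_def v R_def r_def)
qed

lemma para_preserves_cone:
  assumes p: "cmod p = 1" and v: "cmod (v $ 1) = cmod (v $ 2)"
  shows "cmod ((para p s *v v) $ 1) = cmod ((para p s *v v) $ 2)"
proof -
  have 1: "p * cnj p = 1" by (rule mult_cnj_unit) fact
  have 2: "v $ 1 * cnj (v $ 1) = v $ 2 * cnj (v $ 2)"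
    using v by (simp flip: complex_norm_square)
  have "(para p s *v v) $ 1 * cnj ((para p s *v v) $ 1) = (para p s *v v) $ 2 * cnj ((para p s *v v) $ 2)"
    unfolding para_mult_vec[OF p] complex_cnj_add complex_cnj_mult complex_cnj_diff complex_cnj_cnj complex_cnj_i
      complex_cnj_complex_of_real
    using 1 2 by algebra
  then have "(cmod ((para p s *v v) $ 1))\<^sup>2 = (cmod ((para p s *v v) $ 2))\<^sup>2"
    by (metis complex_norm_square of_real_eq_iff)
  then show ?thesis by simp
qed

text \<open>Here \<open>\<beta>\<close> is fixed while \<open>\<alpha>\<close> changes by \<open>2 \<i> s \<beta>\<close>. On the exterior of the arc \<open>\<alpha> / \<beta>\<close> has modulus
less than \<open>cot (l / 2)\<close>, and a translation by at least twice that amount leaves this interval. The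
bound on \<open>s\<close> is attained by the parabolic element whose isometric arcs have length \<open>l\<close>, and it holds
for all of its nontrivial powers.\<close>

lemma para_ping_pong:
  assumes p: "cmod p = 1" and l: "0 < l" "l < pi" and s: "cot (l / 2) \<le> \<bar>s\<bar>"
    and v: "v \<in> coarc_cone p l"
  shows "para p s *v v \<in> arc_cone p l"
proof -
  have eq: "cmod (v $ 1) = cmod (v $ 2)" using v by (simp add: coarc_cone_def)
  define \<alpha> \<beta> where "\<alpha> = v $ 1 + p * v $ 2" and "\<beta> = v $ 1 - p * v $ 2"
  have p1: "p * cnj p = 1" by (rule mult_cnj_unit) fact
  have 1: "(para p s *v v) $ 1 + p * (para p s *v v) $ 2 = \<alpha> + 2 * \<i> * s * \<beta>"
    unfolding para_mult_vec[OF p] \<alpha>_def \<beta>_def using p1 by algebra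
  have 2: "(para p s *v v) $ 1 - p * (para p s *v v) $ 2 = \<beta>"
    unfolding para_mult_vec[OF p] \<alpha>_def \<beta>_def using p1 by algebra
  have lt: "cmod \<alpha> < cot (l / 2) * cmod \<beta>"
    using v by (simp add: cone_via_cot[OF p l eq] \<alpha>_def \<beta>_def)
  have "cot (l / 2) * cmod \<beta> \<le> \<bar>s\<bar> * cmod \<beta>" using s by (simp add: mult_right_mono)
  moreover have "2 * \<bar>s\<bar> * cmod \<beta> \<le> cmod (\<alpha> + 2 * \<i> * s * \<beta>) + cmod \<alpha>"
    using norm_triangle_ineq4[of "\<alpha> + 2 * \<i> * s * \<beta>" \<alpha>] by (simp add: norm_mult)
  ultimately have "cot (l / 2) * cmod \<beta> < cmod (\<alpha> + 2 * \<i> * s * \<beta>)" using lt by linarith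
  then show ?thesis
    by (simp add: cone_via_cot[OF p l para_preserves_cone[OF p eq]] 1 2)
qed

text \<open>This is the triangle inequality for the angular distance: \<open>sep\<close> says that \<open>p\<close> and \<open>q\<close> are
more than \<open>l + k\<close> apart, so \<open>z\<close> cannot be within \<open>l\<close> of \<open>p\<close> and within \<open>k\<close> of \<open>q\<close>.\<close>

lemma disjoint_arcs:
  assumes p: "cmod p = 1" and q: "cmod q = 1" and z: "cmod z = 1"
    and l: "0 \<le> l" and k: "0 \<le> k" and lk: "l + k \<le> pi"
    and sep: "Re (p * cnj q) < cos (l + k)" and zp: "cos l \<le> Re (z * cnj p)"
  shows "Re (z * cnj q) < cos k"
proof (rule ccontr)
  assume "\<not> ?thesis"
  then have zq: "cos k \<le> Re (z * cnj q)" by simp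
  define u w where "u = z * cnj p" and "w = z * cnj q"
  have unit: "cmod u = 1" "cmod w = 1" using p q z by (simp_all add: u_def w_def norm_mult)
  have u1: "(Re u)\<^sup>2 + (Im u)\<^sup>2 = 1" and w1: "(Re w)\<^sup>2 + (Im w)\<^sup>2 = 1"
    using unit cmod_power2[of u] cmod_power2[of w] by simp_all
  have ru: "\<bar>Re u\<bar> \<le> 1" and rw: "\<bar>Re w\<bar> \<le> 1"
    using unit abs_Re_le_cmod[of u] abs_Re_le_cmod[of w] by simp_all
  define \<phi> \<psi> where "\<phi> = arccos (Re u)" and "\<psi> = arccos (Re w)"
  have c: "cos \<phi> = Re u" "cos \<psi> = Re w" using ru rw by (auto simp: \<phi>_def \<psi>_def intro!: cos_arccos)
  have r: "0 \<le> \<phi>" "\<phi> \<le> pi" "0 \<le> \<psi>" "\<psi> \<le> pi"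
    using ru rw by (auto simp: \<phi>_def \<psi>_def intro!: arccos_lbound arccos_ubound)
  have "1 - (Re u)\<^sup>2 = (Im u)\<^sup>2" "1 - (Re w)\<^sup>2 = (Im w)\<^sup>2" using u1 w1 by linarith+
  then have s: "sin \<phi> = \<bar>Im u\<bar>" "sin \<psi> = \<bar>Im w\<bar>"
    using ru rw by (simp_all add: \<phi>_def \<psi>_def sin_arccos_abs)
  have "\<not> l < \<phi>" using cos_monotone_0_pi[of l \<phi>] l r zp by (auto simp: c u_def)
  moreover have "\<not> k < \<psi>" using cos_monotone_0_pi[of k \<psi>] k r zq by (auto simp: c w_def)
  ultimately have "\<phi> \<le> l" "\<psi> \<le> k" by auto
  then have "cos (l + k) \<le> cos (\<phi> + \<psi>)" using r lk by (intro cos_monotone_0_pi_le) auto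
  also have "\<dots> = Re u * Re w - \<bar>Im u * Im w\<bar>" by (simp add: cos_add c s abs_mult)
  also have "\<dots> \<le> Re u * Re w + Im u * Im w" by linarith
  also have "\<dots> = Re (cnj u * w)" by simp
  also have "cnj u * w = p * cnj q * (z * cnj z)" by (simp add: u_def w_def)
  finally show False using sep mult_cnj_unit[OF z] by simp
qed

lemma arc_cone_subset_coarc_cone:
  assumes p: "cmod p = 1" and q: "cmod q = 1"
    and l: "0 \<le> l" and k: "0 \<le> k" and lk: "l + k \<le> pi"
    and sep: "Re (p * cnj q) < cos (l + k)"
  shows "arc_cone p l \<subseteq> coarc_cone q k"
proof
  fix v assume v: "v \<in> arc_cone p l"
  then have eq: "cmod (v $ 1) = cmod (v $ 2)"
    and lt: "(cmod (v $ 1))\<^sup>2 * cos l < Re (v $ 1 * cnj (p * v $ 2))" by (auto simp: arc_cone_def)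
  define r where "r = (cmod (v $ 1))\<^sup>2"
  have nz: "v $ 1 \<noteq> 0" using lt by auto
  then have r: "r > 0" by (simp add: r_def)
  define z where "z = v $ 1 * cnj (v $ 2) / r"
  have z1: "cmod z = 1" using nz by (simp add: z_def norm_mult norm_divide r_def power2_eq_square flip: eq)
  have Rz: "Re (v $ 1 * cnj (c * v $ 2)) = r * Re (z * cnj c)" for c
  proof -
    have "of_real r * z = v $ 1 * cnj (v $ 2)" using r by (simp add: z_def)
    then have "v $ 1 * cnj (c * v $ 2) = of_real r * (z * cnj c)" 
      by (simp add: mult.assoc[symmetric])
    moreover have "Re (of_real r * w) = r * Re w" for w by simp
    ultimately show ?thesis by metis
  qed
  have "cos l \<le> Re (z * cnj p)" using lt r unfolding Rz r_def[symmetric] by simp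
  then have "Re (z * cnj q) < cos k" by (rule disjoint_arcs[OF p q z1 l k lk sep])
  then have "r * Re (z * cnj q) < r * cos k" using r by (rule mult_strict_left_mono)
  then show "v \<in> coarc_cone q k"
    unfolding coarc_cone_def mem_Collect_eq Rz r_def[symmetric] using eq by (rule conjI[rotated])
qed

section \<open>Disjoint arcs generate a discrete group\<close>

definition para_powers :: "complex \<Rightarrow> real \<Rightarrow> complex \<Rightarrow> real \<Rightarrow> bool \<Rightarrow> int \<Rightarrow> complex^2^2" where
  "para_powers p s q t b n = para (if b then p else q) (of_int n * (if b then s else t))"

lemma two_cyclic_para_powers:
  assumes "cmod p = 1" "cmod q = 1"
  shows "two_cyclic (para_powers p s q t)"
  unfolding para_powers_def by (rule two_cyclic_para) (simp add: assms)

lemma exists_common_exterior_point: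
  assumes p: "cmod p = 1" and q: "cmod q = 1"
    and l: "0 < l" and k: "0 < k" and lk: "l + k < pi"
    and sep: "Re (p * cnj q) < cos (l + k)"
  obtains z where "cmod z = 1" "Re (z * cnj p) < cos l" "Re (z * cnj q) < cos k"
proof -
  have "\<bar>Re (p * cnj q)\<bar> \<le> 1" using abs_Re_le_cmod[of "p * cnj q"] p q by (simp add: norm_mult)
  then have \<theta>: "cos (arccos (Re (p * cnj q))) = Re (p * cnj q)"
      "0 \<le> arccos (Re (p * cnj q))" "arccos (Re (p * cnj q)) \<le> pi"
    by (auto intro: arccos_lbound arccos_ubound)
  define \<theta> where "\<theta> = arccos (Re (p * cnj q))"
  have lt: "l + k < \<theta>"
  proof (rule ccontr)
    assume "\<not> ?thesis"
    then have "cos (l + k) \<le> cos \<theta>" using \<theta> lk by (intro cos_monotone_0_pi_le) (auto simp: \<theta>_def)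
    then show False using sep \<theta> by (simp add: \<theta>_def)
  qed
  \<comment> \<open>a slightly longer arc about \<open>p\<close> is still disjoint from the arc about \<open>q\<close>; \<open>z\<close> is one of its endpoints\<close>
  define l' where "l' = (l + (\<theta> - k)) / 2"
  have l': "l < l'" "l' + k < \<theta>" "l' < pi" "l' + k \<le> pi"
    using lt k \<theta>(3) by (auto simp: l'_def \<theta>_def field_simps)
  define z where "z = p * cis l'"
  have z: "cmod z = 1" by (simp add: z_def norm_mult p)
  have "z * cnj p = cis l'" using mult_cnj_unit[OF p] by (simp add: z_def mult.commute mult.left_commute)
  then have zp: "Re (z * cnj p) = cos l'" by simp
  have "Re (p * cnj q) < cos (l' + k)"
    using cos_monotone_0_pi[of "l' + k" \<theta>] l' l k \<theta> by (simp add: \<theta>_def)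
  then have "Re (z * cnj q) < cos k"
    using l k l' zp by (intro disjoint_arcs[OF p q z, of l' k]) auto
  moreover have "Re (z * cnj p) < cos l" unfolding zp using l l' by (intro cos_monotone_0_pi) auto
  ultimately show ?thesis using z that by blast
qed

text \<open>By ping-pong every nontrivial word moves a common exterior point into one of the two arcs, while the
strict inequalities that define the exterior persist under all matrices near \<open>\<plusminus> 1\<close>.\<close>

lemma discrete_of_disjoint_arcs:
  assumes p: "cmod p = 1" and q: "cmod q = 1"
    and l: "0 < l" and k: "0 < k" and lk: "l + k < pi"
    and sep: "Re (p * cnj q) < cos (l + k)"
  shows "discrete_in_PSL2C
    (psl_proj ` range (word (para_powers p (cot (l / 2)) q (cot (k / 2)))))"
proof -
  let ?P = "para_powers p (cot (l / 2)) q (cot (k / 2))"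
  interpret two_cyclic ?P by (rule two_cyclic_para_powers) fact+
  define c where "c b = (if b then p else q)" for b
  define m where "m b = (if b then l else k)" for b
  have c: "cmod (c b) = 1" for b by (simp add: c_def p q)
  have m: "0 < m b" "m b < pi" for b using l k lk by (auto simp: m_def)
  have sep': "Re (c (\<not> b) * cnj (c b)) < cos (m (\<not> b) + m b)" for b
    using sep by (cases b) (simp_all add: c_def m_def add.commute mult.commute)
  have P: "?P b n = para (c b) (of_int n * cot (m b / 2))" for b n
    by (simp add: para_powers_def c_def m_def)
  have step: "?P b n *v v \<in> arc_cone (c b) (m b)" if "n \<noteq> 0" "v \<in> coarc_cone (c b) (m b)" for b n v
  proof -
    have "1 * cot (m b / 2) \<le> \<bar>real_of_int n\<bar> * \<bar>cot (m b / 2)\<bar>"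
      using that(1) cot_half_sq(1)[OF m] by (intro mult_mono) (auto simp: less_imp_le)
    then show ?thesis unfolding P by (intro para_ping_pong c m that(2)) (simp add: abs_mult)
  qed
  have sub: "arc_cone (c (\<not> b)) (m (\<not> b)) \<subseteq> coarc_cone (c b) (m b)" for b
    using m sep' lk by (intro arc_cone_subset_coarc_cone c) (auto simp: less_imp_le m_def)
  obtain z where z: "cmod z = 1" "Re (z * cnj p) < cos l" "Re (z * cnj q) < cos k"
    using exists_common_exterior_point[OF assms] by blast
  define v :: "complex^2" where "v = vector [z, 1]"
  have v: "v \<in> coarc_cone (c b) (m b)" for b
    using z by (simp add: coarc_cone_def v_def c_def m_def)
  \<comment> \<open>the matrices that move \<open>v\<close> to a direction outside both arcs; without the requirement that the
    two entries have equal modulus this is an open condition\<close>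
  define W where "W = {A :: complex^2^2. \<forall>b. Re ((A *v v) $ 1 * cnj (c b * (A *v v) $ 2)) < (cmod ((A *v v) $ 1))\<^sup>2 * cos (m b)}"
  have "continuous_on UNIV (\<lambda>A :: complex^2^2. A *v v)"
    unfolding matrix_vector_mult_def by (intro continuous_intros)
  then have "open W" unfolding W_def all_bool_eq
    by (intro open_Collect_conj open_Collect_less continuous_intros)
  moreover have "mat 1 \<in> W" 
    using v unfolding W_def coarc_cone_def matrix_vector_mul_lid mem_Collect_eq by blast
  ultimately obtain e where e: "e > 0" "\<And>A. dist A (mat 1) < e \<Longrightarrow> A \<in> W"
    unfolding open_dist by blast
  have neg: "(- A) *v v = - (A *v v)" for A :: "complex^2^2"
    by (simp add: vec_eq_iff matrix_vector_mult_def sum_negf)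
  have W_minus: "- A \<in> W \<longleftrightarrow> A \<in> W" for A 
    by (simp only: W_def neg mem_Collect_eq vector_uminus_component mult_minus_right mult_minus_left
        complex_cnj_minus minus_minus norm_minus_cancel)
  have "word ?P w \<notin> W" if "word ?P w \<noteq> mat 1" for w
  proof -
    have "\<exists>b. word ?P w *v v \<in> arc_cone (c b) (m b)"
      by (rule ping_pong[where Out = "\<lambda>b. coarc_cone (c b) (m b)"]) (fact step sub v that)+
    then show ?thesis unfolding W_def arc_cone_def mem_Collect_eq using less_asym by blast
  qed
  then have "A = mat 1 \<or> A \<notin> W" if "A \<in> range (word ?P)" for A using that by blast
  then have "A = mat 1 \<or> A = - mat 1 \<or> e \<le> dist A (mat 1) \<and> e \<le> dist (- A) (mat 1)"
    if "A \<in> range (word ?P)" for A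
    using that e(2)[of A] e(2)[of "- A"] W_minus[of A] unfolding linorder_not_less[symmetric] by blast
  then show ?thesis unfolding discrete_psl_image_iff[OF subgroup_words] using e(1) by blast
qed

section \<open>Discreteness is a measurable event\<close>

lemma continuous_word_para_powers:
  "continuous_on UNIV (\<lambda>x. word (para_powers (fst x) (fst (snd x)) (fst (snd (snd x))) (snd (snd (snd x)))) w)"
proof (induction w)
  case (Cons y w)
  have para: "continuous_on UNIV (\<lambda>x. para (g x) (h x))"
    if "continuous_on UNIV g" "continuous_on UNIV h"
    for g :: "complex \<times> real \<times> complex \<times> real \<Rightarrow> complex" and h
  proof -
    have row: "(vector [a, b] :: 'a::zero^2) = (\<chi> i. if i = 1 then a else b)" for a b
      by (simp add: vec_eq_iff forall_2)
    show ?thesis unfolding para_def row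
      by (rule continuous_on_vec_lambda, rename_tac i, case_tac "i = 1"; simp,
        rule continuous_on_vec_lambda, rename_tac j, case_tac "j = 1"; simp; intro continuous_intros that)
  qed
  have "continuous_on UNIV (\<lambda>x. para_powers (fst x) (fst (snd x)) (fst (snd (snd x))) (snd (snd (snd x))) b n)" for b n
    unfolding para_powers_def by (cases b; simp; intro para continuous_intros)
  then show ?case unfolding word.simps by (intro continuous_on_matrix_mult Cons)
qed (simp add: continuous_on_const)

text \<open>Discreteness says that there is a bound \<open>1 / (n + 1)\<close> such that every word is \<open>\<plusminus> 1\<close> or at least that far
from \<open>\<plusminus> 1\<close>. There are countably many words, and each depends continuously on the parameters. Without
this lemma the probability in the theorem would have no meaning, since the measure function is zero
on sets that are not measurable.\<close>

lemma measurable_discreteness: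
  assumes [measurable]: "p \<in> borel_measurable M" "q \<in> borel_measurable M"
      "s \<in> borel_measurable M" "t \<in> borel_measurable M"
    and unit: "\<And>\<omega>. \<omega> \<in> space M \<Longrightarrow> cmod (p \<omega>) = 1" "\<And>\<omega>. \<omega> \<in> space M \<Longrightarrow> cmod (q \<omega>) = 1"
  shows "{\<omega> \<in> space M. discrete_in_PSL2C
    (psl_proj ` range (word (para_powers (p \<omega>) (s \<omega>) (q \<omega>) (t \<omega>))))} \<in> sets M"
proof -
  define A where "A w \<omega> = word (para_powers (p \<omega>) (s \<omega>) (q \<omega>) (t \<omega>)) w" for w \<omega>
  have A [measurable]: "A w \<in> borel_measurable M" for w
    using borel_measurable_continuous_on[OF continuous_word_para_powers[of w],
        of "\<lambda>\<omega>. (p \<omega>, s \<omega>, q \<omega>, t \<omega>)" M] by (simp add: A_def[abs_def])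
  define a b where "a w \<omega> = dist (A w \<omega>) (mat 1)" and "b w \<omega> = dist (- A w \<omega>) (mat 1)" for w \<omega>
  have [measurable]: "a w \<in> borel_measurable M" "b w \<in> borel_measurable M" for w
    unfolding a_def[abs_def] b_def[abs_def] by measurable
  have "discrete_in_PSL2C (psl_proj ` range (word (para_powers (p \<omega>) (s \<omega>) (q \<omega>) (t \<omega>)))) \<longleftrightarrow>
      (\<exists>n. \<forall>w. a w \<omega> = 0 \<or> b w \<omega> = 0 \<or> 1 / real (Suc n) \<le> a w \<omega> \<and> 1 / real (Suc n) \<le> b w \<omega>)"
    (is "?L \<longleftrightarrow> ?R") if "\<omega> \<in> space M" for \<omega>
  proof -
    interpret two_cyclic "para_powers (p \<omega>) (s \<omega>) (q \<omega>) (t \<omega>)"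
      by (intro two_cyclic_para_powers unit that)
    have 1: "A w \<omega> = mat 1 \<longleftrightarrow> a w \<omega> = 0" "A w \<omega> = - mat 1 \<longleftrightarrow> b w \<omega> = 0" for w
      by (auto simp: a_def b_def minus_equation_iff)
    have L: "?L \<longleftrightarrow> (\<exists>e>0. \<forall>w. a w \<omega> = 0 \<or> b w \<omega> = 0 \<or> e \<le> a w \<omega> \<and> e \<le> b w \<omega>)"
      unfolding discrete_psl_image_iff[OF subgroup_words] 1[symmetric] unfolding a_def b_def A_def
      by blast
    show ?thesis
    proof
      assume ?L
      then obtain e where e: "e > 0" "\<And>w. a w \<omega> = 0 \<or> b w \<omega> = 0 \<or> e \<le> a w \<omega> \<and> e \<le> b w \<omega>"
        unfolding L by blast
      obtain n where "1 / real (Suc n) < e" using nat_approx_posE[OF e(1)] by blast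
      then show ?R using e(2) by (meson less_imp_le order_trans)
    next
      assume ?R
      then show ?L unfolding L by (meson zero_less_divide_1_iff of_nat_0_less_iff zero_less_Suc)
    qed
  qed
  then have "{\<omega> \<in> space M. discrete_in_PSL2C
      (psl_proj ` range (word (para_powers (p \<omega>) (s \<omega>) (q \<omega>) (t \<omega>))))} =
    {\<omega> \<in> space M. \<exists>n. \<forall>w. a w \<omega> = 0 \<or> b w \<omega> = 0 \<or> 1 / real (Suc n) \<le> a w \<omega> \<and> 1 / real (Suc n) \<le> b w \<omega>}"
    by blast
  also have "\<dots> \<in> sets M" by measurable
  finally show ?thesis .
qed

section \<open>The matrix of a parabolic element with given isometric arcs\<close>

text \<open>The endpoints of the arc lie in its closure, hence in the closed disk; the far one is a point of the
circle that does not belong to the open arc, so it lies on the boundary of the disk.\<close>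

lemma arc_endpoints:
  assumes p: "cmod p = 1" and l: "0 < l" "l < pi" and \<sigma>: "\<sigma> \<in> {1, -1}"
    and arc: "ball x r \<inter> sphere 0 1 = (\<lambda>t. p * cis (\<sigma> * t)) ` {0<..<l}"
  shows "p \<in> cball x r" and "p * cis (\<sigma> * l) \<in> sphere x r"
proof -
  let ?g = "\<lambda>t. p * cis (\<sigma> * t)"
  have "?g ` {0<..<l} \<subseteq> ball x r" using arc by blast
  then have "?g ` {0<..<l} \<subseteq> cball x r" using ball_subset_cball by (rule subset_trans)
  then have "?g ` closure {0<..<l} \<subseteq> cball x r"
    by (intro image_closure_subset continuous_intros closed_cball)
  then have sub: "?g ` {0..l} \<subseteq> cball x r" using l by simp
  have clos: "?g t \<in> cball x r" if "0 \<le> t" "t \<le> l" for t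
    using that by (intro subsetD[OF sub] imageI) simp
  then show "p \<in> cball x r" using clos[of 0] l by simp
  have "?g l \<notin> ?g ` {0<..<l}"
  proof
    assume "?g l \<in> ?g ` {0<..<l}"
    then obtain t where t: "0 < t" "t < l" "cis (\<sigma> * l) = cis (\<sigma> * t)" using p by auto
    from t(3) have "cos (\<sigma> * l) = cos (\<sigma> * t)" by (simp add: complex_eq_iff)
    then have "cos l = cos t" using \<sigma> by auto
    then show False using cos_monotone_0_pi[of t l] t l by simp
  qed
  moreover have "?g l \<in> sphere 0 1" by (simp add: norm_mult p)
  ultimately have "?g l \<notin> ball x r" using arc by blast
  then show "?g l \<in> sphere x r" using clos[of l] l by simp
qed

lemma parabolic_obtain_para:
  assumes "parabolic f"
  obtains s p where "s \<noteq> 0" "cmod p = 1" "f = psl_proj (para p s)"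
    "{ball (p * (1 + \<i> / s)) (1 / \<bar>s\<bar>) \<inter> sphere 0 1, ball (p * (1 - \<i> / s)) (1 / \<bar>s\<bar>) \<inter> sphere 0 1}
      \<subseteq> isometric_arcs f"
proof -
  obtain a c where ac: "(cmod a)\<^sup>2 - (cmod c)\<^sup>2 = 1" "f = disk_elem a c" "Re a = 1"
  proof -
    obtain a c where 1: "(cmod a)\<^sup>2 - (cmod c)\<^sup>2 = 1" "f = disk_elem a c" "Re a = 1 \<or> Re a = - 1"
      using assms by (auto simp: parabolic_def)
    have "disk_elem (- a) (- c) = disk_elem a c"
      unfolding disk_elem_def psl_proj_eq_iff by (simp add: vec2_eq_iff)
    then show ?thesis using 1 that[of a c] that[of "- a" "- c"] by auto
  qed
  \<comment> \<open>with \<open>Re a = 1\<close> the norm condition becomes \<open>\<bar>c\<bar> = \<bar>Im a\<bar>\<close>, and the phase of \<open>c\<close> is the fixed point\<close>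
  define s where "s = Im a"
  have a: "a = 1 + \<i> * s" using ac(3) by (simp add: complex_eq_iff s_def)
  have "(cmod c)\<^sup>2 = s\<^sup>2" using ac(1) by (simp add: cmod_power2 ac(3) s_def)
  then have c_norm: "cmod c = \<bar>s\<bar>" using power2_eq_imp_eq[of "cmod c" "\<bar>s\<bar>"] by simp
  have s0: "s \<noteq> 0"
  proof
    assume "s = 0"
    then have "f = \<one>\<^bsub>PSL2C\<^esub>" using a c_norm ac(2)
      by (simp add: disk_elem_def one_PSL2C psl_proj_eq_iff vec2_eq_iff mat_def)
    then show False using assms by (simp add: parabolic_def)
  qed
  define p where "p = \<i> * c / s"
  have p: "cmod p = 1" using s0 by (simp add: p_def norm_mult norm_divide c_norm)
  have c: "c = - (\<i> * s * p)" using s0 by (simp add: p_def)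
  have f: "f = psl_proj (para p s)"
    by (simp add: ac(2) disk_elem_def para_def a c)
  have c0: "c \<noteq> 0" using c_norm s0 by auto
  have pp: "p * cnj p = 1" by (rule mult_cnj_unit) fact
  have cc: "cnj c * p = \<i> * s" using pp by (simp add: c mult.commute)
  have centres: "- cnj a / cnj c = p * (1 + \<i> / s)" "a / cnj c = p * (1 - \<i> / s)"
    using c0 s0 cc by (simp_all add: a field_simps)
  have "{ball (- cnj a / cnj c) (1 / cmod c) \<inter> sphere 0 1, ball (a / cnj c) (1 / cmod c) \<inter> sphere 0 1}
      \<subseteq> isometric_arcs f"
    unfolding isometric_arcs_def
    by (rule order_trans[OF _ UN_upper[of "(a, c)"]]) (use ac c0 in auto)
  then have "{ball (p * (1 + \<i> / s)) (1 / \<bar>s\<bar>) \<inter> sphere 0 1, ball (p * (1 - \<i> / s)) (1 / \<bar>s\<bar>) \<inter> sphere 0 1}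
      \<subseteq> isometric_arcs f"
    unfolding centres c_norm .
  then show ?thesis using that s0 p f by blast
qed

text \<open>The two isometric disks touch only at the fixed point, which must therefore be the common endpoint \<open>p\<close>
of the two arcs; the far endpoint of one arc then determines the radius \<open>1 / \<bar>s\<bar>\<close>.\<close>

lemma parabolic_with_para:
  assumes "parabolic_with p l f"
  shows "f \<in> {psl_proj (para p (cot (l / 2))), psl_proj (para p (- cot (l / 2)))}"
proof -
  have p: "cmod p = 1" and l: "0 < l" "l < pi" and "parabolic f"
    and arcs: "isometric_arcs f = {(\<lambda>t. p * cis t) ` {0<..<l}, (\<lambda>t. p * cis (- t)) ` {0<..<l}}"
    using assms by (auto simp: parabolic_with_def)
  obtain s p' where s: "s \<noteq> 0" and p': "cmod p' = 1" and f: "f = psl_proj (para p' s)"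
    and sub: "{ball (p' * (1 + \<i> / s)) (1 / \<bar>s\<bar>) \<inter> sphere 0 1, ball (p' * (1 - \<i> / s)) (1 / \<bar>s\<bar>) \<inter> sphere 0 1}
      \<subseteq> isometric_arcs f"
    using parabolic_obtain_para[OF \<open>parabolic f\<close>] by blast
  have signed: "\<exists>\<sigma>\<in>{1, -1}. X = (\<lambda>t. p * cis (\<sigma> * t)) ` {0<..<l}" if "X \<in> isometric_arcs f" for X
    using that unfolding arcs by auto
  obtain \<sigma> where \<sigma>: "\<sigma> \<in> {1, -1}"
    and 1: "ball (p' * (1 + \<i> / s)) (1 / \<bar>s\<bar>) \<inter> sphere 0 1 = (\<lambda>t. p * cis (\<sigma> * t)) ` {0<..<l}"
    using sub signed by (metis insert_subset)
  obtain \<tau> where \<tau>: "\<tau> \<in> {1, -1}"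
    and 2: "ball (p' * (1 - \<i> / s)) (1 / \<bar>s\<bar>) \<inter> sphere 0 1 = (\<lambda>t. p * cis (\<tau> * t)) ` {0<..<l}"
    using sub signed by (metis insert_subset)
  \<comment> \<open>\<open>p\<close> lies in both closed disks; by the parallelogram law only their point of tangency \<open>p'\<close> does\<close>
  define d e where "d = p - p'" and "e = p' * (\<i> / s)"
  have e: "cmod e = 1 / \<bar>s\<bar>" by (simp add: e_def norm_mult norm_divide p')
  have "cmod (d - e) \<le> cmod e" "cmod (d + e) \<le> cmod e"
    using arc_endpoints(1)[OF p l \<sigma> 1] arc_endpoints(1)[OF p l \<tau> 2]
    unfolding e by (simp_all add: dist_norm norm_minus_commute d_def e_def algebra_simps)
  then have "(cmod (d - e))\<^sup>2 \<le> (cmod e)\<^sup>2" "(cmod (d + e))\<^sup>2 \<le> (cmod e)\<^sup>2"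
    by (simp_all add: power_mono)
  moreover have "(cmod (d - e))\<^sup>2 + (cmod (d + e))\<^sup>2 = 2 * (cmod d)\<^sup>2 + 2 * (cmod e)\<^sup>2"
    using cmod_add_sq[of d e] cmod_add_sq[of d "- e"] by simp
  ultimately have "(cmod d)\<^sup>2 \<le> 0" by linarith
  then have pp': "p' = p" by (simp add: d_def)
  \<comment> \<open>the far endpoint of the arc lies on the boundary circle, which is an equation for \<open>s\<close>\<close>
  have "cmod (p * cis (\<sigma> * l) - p * (1 + \<i> / s)) = 1 / \<bar>s\<bar>"
    using arc_endpoints(2)[OF p l \<sigma> 1] by (simp add: pp' dist_norm norm_minus_commute)
  also have "p * cis (\<sigma> * l) - p * (1 + \<i> / s) = p * (cis (\<sigma> * l) - (1 + \<i> / s))"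
    by (simp add: algebra_simps)
  finally have "cmod (cis (\<sigma> * l) - (1 + \<i> / s)) = 1 / \<bar>s\<bar>" by (simp add: norm_mult p)
  then have "(cmod (cis (\<sigma> * l) - (1 + \<i> / s)))\<^sup>2 = 1 / s\<^sup>2" by (simp add: power_divide)
  then have "(cos (\<sigma> * l) - 1)\<^sup>2 + (sin (\<sigma> * l) - 1 / s)\<^sup>2 = 1 / s\<^sup>2"
    by (simp add: cmod_power2)
  moreover have "cos (\<sigma> * l) = cos l" "sin (\<sigma> * l) = \<sigma> * sin l" "\<sigma>\<^sup>2 = 1" using \<sigma> by auto
  ultimately have "(cos l - 1)\<^sup>2 + (\<sigma> * sin l - 1 / s)\<^sup>2 = 1 / s\<^sup>2" by simp
  then have *: "s * (1 - cos l) = \<sigma> * sin l"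
  proof -
    assume h: "(cos l - 1)\<^sup>2 + (\<sigma> * sin l - 1 / s)\<^sup>2 = 1 / s\<^sup>2"
    have "(sin l)\<^sup>2 + (cos l)\<^sup>2 = 1" by simp
    moreover define u where "u = 1 / s"
    moreover have "u * s = 1" "1 / s\<^sup>2 = u\<^sup>2" using s by (simp_all add: u_def power_divide)
    ultimately show ?thesis using h \<open>\<sigma>\<^sup>2 = 1\<close> by algebra
  qed
  have sn: "0 < sin (l / 2)" using l by (intro sin_gt_zero) auto
  have "1 - cos l = 2 * (sin (l / 2))\<^sup>2" "sin l = 2 * sin (l / 2) * cos (l / 2)"
    using cos_double_sin[of "l / 2"] sin_double[of "l / 2"] by simp_all
  with * have "s * sin (l / 2) * (2 * sin (l / 2)) = \<sigma> * cos (l / 2) * (2 * sin (l / 2))"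
    by (simp add: power2_eq_square)
  then have "s = \<sigma> * cot (l / 2)" using sn by (simp add: cot_def field_simps)
  then show ?thesis using \<sigma> f pp' by auto
qed

section \<open>Two random arcs are disjoint with probability at least one sixth\<close>

lemma cos_less_of_between:
  assumes "0 \<le> m" "m < x" "x < 2 * pi - m"
  shows "cos x < cos m"
proof (cases "x \<le> pi")
  case True
  then show ?thesis using assms by (intro cos_monotone_0_pi) auto
next
  case False
  have "cos (2 * pi - x) < cos m" using False assms by (intro cos_monotone_0_pi) auto
  then show ?thesis by (simp add: cos_diff)
qed

text \<open>The angles at distance more than \<open>m\<close> from \<open>b\<close> form an open arc of length \<open>2 pi - 2 m\<close> on the circle;
in \<open>[0, 2 pi]\<close> it appears as the part \<open>I\<close> to the right of \<open>b\<close> and the part \<open>J\<close> to the left of \<open>b\<close>, one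
of which may be empty.\<close>

lemma emeasure_far_angles:
  assumes b: "0 \<le> b" "b \<le> 2 * pi" and m: "0 \<le> m" "m < pi"
  shows "ennreal (2 * pi - 2 * m) \<le> emeasure lborel {a \<in> {0..2 * pi}. cos (a - b) < cos m}"
proof -
  let ?S = "{a \<in> {0..2 * pi}. cos (a - b) < cos m}"
  have S: "?S \<in> sets lborel" by measurable
  let ?I = "{b + m<..<min (2 * pi) (b + (2 * pi - m))}"
  let ?J = "{max 0 (b + m - 2 * pi)<..<b - m}"
  have I: "?I \<subseteq> ?S" using b m by (auto intro!: cos_less_of_between)
  have "cos (a - b) < cos m" if "a \<in> ?J" for a
    using that m cos_less_of_between[of m "a - b + 2 * pi"] by simp
  then have J: "?J \<subseteq> ?S" using b m by auto
  consider "b \<le> m" | "2 * pi - m \<le> b" | "m < b" "b < 2 * pi - m" by linarith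
  then show ?thesis
  proof cases
    case 1
    have "ennreal (2 * pi - 2 * m) = emeasure lborel ?I" using 1 m by (simp add: algebra_simps)
    also have "\<dots> \<le> emeasure lborel ?S" by (intro emeasure_mono I S)
    finally show ?thesis .
  next
    case 2
    have "ennreal (2 * pi - 2 * m) = emeasure lborel ?J" using 2 m by (simp add: algebra_simps)
    also have "\<dots> \<le> emeasure lborel ?S" by (intro emeasure_mono J S)
    finally show ?thesis .
  next
    case 3
    have "ennreal (2 * pi - 2 * m) = ennreal (2 * pi - (b + m)) + ennreal (b - m)"
      using 3 by (simp flip: ennreal_plus)
    also have "\<dots> = emeasure lborel ?I + emeasure lborel ?J" using 3 by simp
    also have "\<dots> = emeasure lborel (?I \<union> ?J)"
      using m by (intro plus_emeasure) auto
    also have "\<dots> \<le> emeasure lborel ?S" using I J by (intro emeasure_mono S) auto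
    finally show ?thesis .
  qed
qed

lemma cis_measurable [measurable]: "cis \<in> borel_measurable borel"
  by (intro borel_measurable_continuous_onI continuous_intros)

lemma cnj_measurable [measurable]: "cnj \<in> borel_measurable borel"
  by (intro borel_measurable_continuous_onI continuous_intros)

lemma cos_measurable [measurable]: "(cos :: real \<Rightarrow> real) \<in> borel_measurable borel"
  by (intro borel_measurable_continuous_onI continuous_intros)

lemma sin_measurable [measurable]: "(sin :: real \<Rightarrow> real) \<in> borel_measurable borel"
  by (intro borel_measurable_continuous_onI continuous_intros)

lemma prob_space_uniform_circle: "prob_space uniform_circle"
  unfolding uniform_circle_def
  by (intro prob_space.prob_space_distr prob_space_uniform_measure) auto

lemma sets_uniform_circle [measurable_cong]: "sets uniform_circle = sets borel"
  by (simp add: uniform_circle_def)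

lemma AE_uniform_circle: "AE q in uniform_circle. cmod q = 1"
  unfolding uniform_circle_def by (subst AE_distr_iff) auto

lemma emeasure_uniform_circle_far:
  assumes q: "cmod q = 1" and m: "0 \<le> m" "m < pi"
  shows "ennreal (1 - m / pi) \<le> emeasure uniform_circle {p. Re (p * cnj q) < cos m}"
proof -
  define b where "b = Arg2pi q"
  have b: "0 \<le> b" "b \<le> 2 * pi" "q = cis b"
    using Arg2pi[of q] q by (simp_all add: b_def cis_conv_exp is_Arg_def)
  have re: "Re (cis a * cnj q) = cos (a - b)" for a by (simp add: b cis_cnj cis_mult)
  have "ennreal (1 - m / pi) = ennreal (2 * pi - 2 * m) / ennreal (2 * pi)"
    using m by (subst divide_ennreal) (auto simp: field_simps)
  also have "\<dots> \<le> emeasure lborel {a \<in> {0..2 * pi}. cos (a - b) < cos m} / ennreal (2 * pi)"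
    by (intro divide_right_mono_ennreal emeasure_far_angles b m)
  also have "{a \<in> {0..2 * pi}. cos (a - b) < cos m} = {0..2 * pi} \<inter> (cis -` {p. Re (p * cnj q) < cos m})"
    unfolding re[symmetric] by auto
  also have "emeasure lborel \<dots> / ennreal (2 * pi) = emeasure uniform_circle {p. Re (p * cnj q) < cos m}"
  proof -
    have [measurable]: "{p. Re (p * cnj q) < cos m} \<in> sets borel" by measurable
    have "cis -` {p. Re (p * cnj q) < cos m} \<in> sets borel"
      using measurable_sets[OF cis_measurable, of "{p. Re (p * cnj q) < cos m}"] by simp
    then show ?thesis
      unfolding uniform_circle_def by (simp add: emeasure_distr)
  qed
  finally show ?thesis .
qed

lemma nn_integral_uniform_pi:
  assumes "f \<in> borel_measurable borel"
  shows "(\<integral>\<^sup>+x. f x \<partial>uniform_measure lborel {0..pi}) = (\<integral>\<^sup>+x. f x * indicator {0..pi} x \<partial>lborel) / ennreal pi"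
  using assms by (subst nn_integral_uniform_measure) auto

lemma nn_integral_uniform_pi_mono:
  assumes "f \<in> borel_measurable borel" "g \<in> borel_measurable borel"
    and "\<And>x. 0 \<le> x \<Longrightarrow> x \<le> pi \<Longrightarrow> f x \<le> g x"
  shows "(\<integral>\<^sup>+x. f x \<partial>uniform_measure lborel {0..pi}) \<le> (\<integral>\<^sup>+x. g x \<partial>uniform_measure lborel {0..pi})"
  using assms(3) unfolding nn_integral_uniform_pi[OF assms(1)] nn_integral_uniform_pi[OF assms(2)]
  by (intro divide_right_mono_ennreal nn_integral_mono) (auto simp: indicator_def)

text \<open>For negative arguments \<open>ennreal\<close> is zero, so the integrand is the probability that an arc of radius
\<open>l\<close> with random midpoint avoids a given arc of radius \<open>k\<close>, also when \<open>l + k\<close> exceeds \<open>pi\<close>.\<close>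

lemma integral_gap:
  assumes "0 \<le> k" "k \<le> pi"
  shows "(\<integral>\<^sup>+l. ennreal (1 - (l + k) / pi) \<partial>uniform_measure lborel {0..pi}) = ennreal ((pi - k)\<^sup>2 / (2 * pi\<^sup>2))"
proof -
  have "(\<integral>\<^sup>+l. ennreal (1 - (l + k) / pi) * indicator {0..pi} l \<partial>lborel) / ennreal pi =
    (\<integral>\<^sup>+l. ennreal (1 - (l + k) / pi) * indicator {0..pi - k} l \<partial>lborel) / ennreal pi"
    using assms by (intro arg_cong2[where f = "(/)"] nn_integral_cong refl) (auto simp: indicator_def field_simps intro!: ennreal_neg)
  also have "(\<integral>\<^sup>+l. ennreal (1 - (l + k) / pi) * indicator {0..pi - k} l \<partial>lborel)
      = ennreal (- (pi - k - (pi - k))\<^sup>2 / (2 * pi) - (- (pi - k - 0)\<^sup>2 / (2 * pi)))"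
    using assms by (intro nn_integral_FTC_Icc[where F = "\<lambda>l. - (pi - k - l)\<^sup>2 / (2 * pi)"])
      (auto intro!: derivative_eq_intros simp: field_simps)
  also have "\<dots> / ennreal pi = ennreal ((pi - k)\<^sup>2 / (2 * pi\<^sup>2))"
    by (subst divide_ennreal) (auto simp: power2_eq_square)
  finally show ?thesis by (subst nn_integral_uniform_pi) auto
qed

lemma integral_gap_square:
  "(\<integral>\<^sup>+k. ennreal ((pi - k)\<^sup>2 / (2 * pi\<^sup>2)) \<partial>uniform_measure lborel {0..pi}) = ennreal (1 / 6)"
proof -
  have "(\<integral>\<^sup>+k. ennreal ((pi - k)\<^sup>2 / (2 * pi\<^sup>2)) * indicator {0..pi} k \<partial>lborel) =
     ennreal (- ((pi - pi) ^ 3) / (6 * pi\<^sup>2) - (- ((pi - 0) ^ 3) / (6 * pi\<^sup>2)))"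
    by (intro nn_integral_FTC_Icc[where F = "\<lambda>k. - ((pi - k) ^ 3) / (6 * pi\<^sup>2)"])
      (auto intro!: derivative_eq_intros simp: field_simps)
  also have "\<dots> = ennreal (pi / 6)" by (simp add: power2_eq_square power3_eq_cube)
  finally show ?thesis by (simp add: nn_integral_uniform_pi divide_ennreal)
qed

text \<open>For \<open>x = ((p, l), (q, k))\<close> this says that the arcs of angular radius \<open>l\<close> about \<open>p\<close> and of angular
radius \<open>k\<close> about \<open>q\<close> have disjoint closures, provided that \<open>p\<close>, \<open>q\<close> lie on the unit circle and
\<open>l\<close>, \<open>k\<close> are nonnegative.\<close>

abbreviation arcs_apart :: "((complex \<times> real) \<times> (complex \<times> real)) set" where
  "arcs_apart \<equiv> {x. snd (fst x) + snd (snd x) < pi \<and>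
       Re (fst (fst x) * cnj (fst (snd x))) < cos (snd (fst x) + snd (snd x))}"

lemma sets_disjoint_arcs:
  "arcs_apart \<in> sets ((borel \<Otimes>\<^sub>M borel) \<Otimes>\<^sub>M (borel \<Otimes>\<^sub>M borel))" (is "_ \<in> sets ?N")
proof -
  have "{x \<in> space ?N. x \<in> arcs_apart} \<in> sets ?N"
    unfolding mem_Collect_eq by measurable
  then show ?thesis by (simp add: space_pair_measure)
qed

text \<open>The integrals are taken in the order \<open>p\<close>, \<open>l\<close>, \<open>q\<close>, \<open>k\<close>: given the rest, \<open>p\<close> avoids the arc of radius
\<open>l + k\<close> about \<open>q\<close> with probability \<open>1 - (l + k) / pi\<close>, which depends on neither midpoint, and it remains to
average \<open>max 0 (1 - x - y)\<close> over the unit square.\<close>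

lemma emeasure_disjoint_arcs:
  defines "V \<equiv> uniform_measure lborel {0..pi}"
  shows "1 / 6 \<le> emeasure ((uniform_circle \<Otimes>\<^sub>M V) \<Otimes>\<^sub>M (uniform_circle \<Otimes>\<^sub>M V))
    arcs_apart"
proof -
  interpret U: prob_space uniform_circle by (rule prob_space_uniform_circle)
  interpret V: prob_space V unfolding V_def by (intro prob_space_uniform_measure) auto
  interpret UV: pair_prob_space uniform_circle V ..
  interpret UVUV: pair_prob_space "uniform_circle \<Otimes>\<^sub>M V" "uniform_circle \<Otimes>\<^sub>M V" ..
  have "sets V = sets borel" by (simp add: V_def)
  note [measurable_cong] = this
  have sets: "sets ((uniform_circle \<Otimes>\<^sub>M V) \<Otimes>\<^sub>M (uniform_circle \<Otimes>\<^sub>M V))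
      = sets ((borel \<Otimes>\<^sub>M borel) \<Otimes>\<^sub>M (borel \<Otimes>\<^sub>M borel))"
    by (intro sets_pair_measure_cong sets_uniform_circle \<open>sets V = sets borel\<close>)
  have E [measurable]: "arcs_apart \<in> sets ((uniform_circle \<Otimes>\<^sub>M V) \<Otimes>\<^sub>M (uniform_circle \<Otimes>\<^sub>M V))"
    unfolding sets by (rule sets_disjoint_arcs)
  have inner: "ennreal (1 - (l + k) / pi) \<le> (\<integral>\<^sup>+p. indicator arcs_apart ((p, l), (q, k)) \<partial>uniform_circle)"
    if "cmod q = 1" "0 \<le> l" "0 \<le> k" for q l k
  proof (cases "l + k < pi")
    case True
    have "(\<integral>\<^sup>+p. indicator arcs_apart ((p, l), (q, k)) \<partial>uniform_circle)
        = (\<integral>\<^sup>+p. indicator {p. Re (p * cnj q) < cos (l + k)} p \<partial>uniform_circle)"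
      using True by (intro nn_integral_cong) (auto simp: indicator_def)
    also have "\<dots> = emeasure uniform_circle {p. Re (p * cnj q) < cos (l + k)}"
      by (intro nn_integral_indicator) (simp add: sets_uniform_circle)
    finally show ?thesis using emeasure_uniform_circle_far[of q "l + k"] that True by simp
  next
    case False
    then have "1 - (l + k) / pi \<le> 0" by (simp add: field_simps)
    then show ?thesis by (simp add: ennreal_neg)
  qed
  have "1 / 6 = (\<integral>\<^sup>+k. ennreal ((pi - k)\<^sup>2 / (2 * pi\<^sup>2)) \<partial>V)"
    unfolding V_def integral_gap_square using divide_ennreal[of 1 6] by simp
  also have "\<dots> \<le> (\<integral>\<^sup>+k. \<integral>\<^sup>+q. \<integral>\<^sup>+l. \<integral>\<^sup>+p. indicator arcs_apart ((p, l), (q, k)) \<partial>uniform_circle \<partial>V \<partial>uniform_circle \<partial>V)"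
    unfolding V_def
  proof (rule nn_integral_uniform_pi_mono, unfold V_def[symmetric])
    fix k :: real assume k: "0 \<le> k" "k \<le> pi"
    have "ennreal ((pi - k)\<^sup>2 / (2 * pi\<^sup>2)) = (\<integral>\<^sup>+q. ennreal ((pi - k)\<^sup>2 / (2 * pi\<^sup>2)) \<partial>uniform_circle)"
      by (simp add: U.emeasure_space_1)
    also have "\<dots> \<le> (\<integral>\<^sup>+q. \<integral>\<^sup>+l. \<integral>\<^sup>+p. indicator arcs_apart ((p, l), (q, k)) \<partial>uniform_circle \<partial>V \<partial>uniform_circle)"
    proof (rule nn_integral_mono_AE, rule AE_mp[OF AE_uniform_circle], rule AE_I2, rule impI)
      fix q assume q: "cmod q = 1"
      show "ennreal ((pi - k)\<^sup>2 / (2 * pi\<^sup>2))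
        \<le> (\<integral>\<^sup>+l. \<integral>\<^sup>+p. indicator arcs_apart ((p, l), (q, k)) \<partial>uniform_circle \<partial>V)"
        unfolding integral_gap[OF k, symmetric] V_def
      proof (rule nn_integral_uniform_pi_mono)
        show "(\<lambda>l. ennreal (1 - (l + k) / pi)) \<in> borel_measurable borel" by measurable
        show "(\<lambda>l. \<integral>\<^sup>+p. indicator arcs_apart ((p, l), (q, k)) \<partial>uniform_circle) \<in> borel_measurable borel"
          unfolding indicator_def mem_Collect_eq fst_conv snd_conv by measurable
      qed (rule inner[OF q _ k(1)])
    qed
    finally show "ennreal ((pi - k)\<^sup>2 / (2 * pi\<^sup>2))
      \<le> (\<integral>\<^sup>+q. \<integral>\<^sup>+l. \<integral>\<^sup>+p. indicator arcs_apart ((p, l), (q, k)) \<partial>uniform_circle \<partial>V \<partial>uniform_circle)" .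
  qed measurable
  also have "\<dots> = (\<integral>\<^sup>+k. \<integral>\<^sup>+q. (\<integral>\<^sup>+x. indicator arcs_apart (x, (q, k)) \<partial>(uniform_circle \<Otimes>\<^sub>M V)) \<partial>uniform_circle \<partial>V)"
  proof (intro nn_integral_cong)
    fix q k
    have "(\<lambda>x. indicator arcs_apart (x, (q, k)) :: ennreal) \<in> borel_measurable (uniform_circle \<Otimes>\<^sub>M V)"
      unfolding indicator_def mem_Collect_eq fst_conv snd_conv by measurable
    from UV.nn_integral_snd[OF this]
    show "(\<integral>\<^sup>+l. \<integral>\<^sup>+p. indicator arcs_apart ((p, l), (q, k)) \<partial>uniform_circle \<partial>V)
        = (\<integral>\<^sup>+x. indicator arcs_apart (x, (q, k)) \<partial>(uniform_circle \<Otimes>\<^sub>M V))" .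
  qed
  also have "\<dots> = (\<integral>\<^sup>+y. \<integral>\<^sup>+x. indicator arcs_apart (x, y) \<partial>(uniform_circle \<Otimes>\<^sub>M V) \<partial>(uniform_circle \<Otimes>\<^sub>M V))"
    by (rule UV.nn_integral_snd) measurable
  also have "\<dots> = emeasure ((uniform_circle \<Otimes>\<^sub>M V) \<Otimes>\<^sub>M (uniform_circle \<Otimes>\<^sub>M V)) arcs_apart"
    by (subst UVUV.nn_integral_snd) (rule borel_measurable_indicator[OF E], rule nn_integral_indicator[OF E])
  finally show ?thesis .
qed

section \<open>The probability of discreteness\<close>

text \<open>The two arguments of \<open>indep_var\<close> have the same type, so the hypothesis concerns \<open>p\<close> and the
length embedded into the complex numbers; applying the real part recovers the real length.\<close>

lemma random_parabolic_joint:
  assumes "prob_space M" and r: "random_parabolic M p l f"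
  shows "distr M (borel \<Otimes>\<^sub>M borel) (\<lambda>\<omega>. (p \<omega>, l \<omega>)) = uniform_circle \<Otimes>\<^sub>M uniform_measure lborel {0..pi}"
proof -
  interpret prob_space M by fact
  have [measurable]: "p \<in> borel_measurable M" "l \<in> borel_measurable M"
    and law: "distr M borel p = uniform_circle" "distr M borel l = uniform_measure lborel {0..pi}"
    and indep: "indep_var borel p borel (\<lambda>\<omega>. complex_of_real (l \<omega>))"
    using r by (auto simp: random_parabolic_def)
  let ?l = "\<lambda>\<omega>. complex_of_real (l \<omega>)"
  have [measurable]: "?l \<in> borel_measurable M" by measurable
  have Re_l: "distr (distr M borel ?l) borel Re = uniform_measure lborel {0..pi}"
    by (simp add: distr_distr comp_def law)
  interpret V: prob_space "uniform_measure lborel {0..pi}" by (intro prob_space_uniform_measure) auto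
  have "distr M (borel \<Otimes>\<^sub>M borel) (\<lambda>\<omega>. (p \<omega>, l \<omega>))
      = distr (distr M (borel \<Otimes>\<^sub>M borel) (\<lambda>\<omega>. (p \<omega>, ?l \<omega>))) (borel \<Otimes>\<^sub>M borel) (\<lambda>(x, y). (x, Re y))"
    by (simp add: distr_distr comp_def)
  also have "distr M (borel \<Otimes>\<^sub>M borel) (\<lambda>\<omega>. (p \<omega>, ?l \<omega>)) = distr M borel p \<Otimes>\<^sub>M distr M borel ?l"
    using indep unfolding indep_var_distribution_eq by simp
  also have "distr (distr M borel p \<Otimes>\<^sub>M distr M borel ?l) (borel \<Otimes>\<^sub>M borel) (\<lambda>(x, y). (x, Re y))
      = distr (distr M borel p) borel (\<lambda>x. x) \<Otimes>\<^sub>M distr (distr M borel ?l) borel Re"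
    by (intro pair_measure_distr[symmetric]) (simp_all add: Re_l V.sigma_finite_measure_axioms)
  also have "distr (distr M borel p) borel (\<lambda>x. x) = uniform_circle"
    by (subst distr_distr) (simp_all add: comp_def law)
  finally show ?thesis unfolding Re_l .
qed

theorem theorem7p5:
  fixes M :: "'w measure"
    and p q :: "'w \<Rightarrow> complex" and l k :: "'w \<Rightarrow> real"
    and f g :: "'w \<Rightarrow> (complex^2^2) set"
  assumes "prob_space M"
    and "random_parabolic M p l f"
    and "random_parabolic M q k g"
    and "prob_space.indep_var M
           (borel \<Otimes>\<^sub>M borel) (\<lambda>\<omega>. (p \<omega>, l \<omega>)) (borel \<Otimes>\<^sub>M borel) (\<lambda>\<omega>. (q \<omega>, k \<omega>))"
  shows "measure M {\<omega> \<in> space M. discrete_in_PSL2C (generate PSL2C {f \<omega>, g \<omega>})} \<ge> 1 / 6"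
proof -
  interpret prob_space M by fact
  let ?V = "uniform_measure lborel {0..pi}"
  have [measurable]: "p \<in> borel_measurable M" "q \<in> borel_measurable M"
      "l \<in> borel_measurable M" "k \<in> borel_measurable M"
    using assms(2,3) by (auto simp: random_parabolic_def)
  have f: "parabolic_with (p \<omega>) (l \<omega>) (f \<omega>)" and g: "parabolic_with (q \<omega>) (k \<omega>) (g \<omega>)"
    if "\<omega> \<in> space M" for \<omega>
    using assms(2,3) that by (auto simp: random_parabolic_def)
  have range: "cmod (p \<omega>) = 1" "cmod (q \<omega>) = 1" "0 < l \<omega>" "0 < k \<omega>" if "\<omega> \<in> space M" for \<omega>
    using f[OF that] g[OF that] by (auto simp: parabolic_with_def)
  define P where "P \<omega> = para_powers (p \<omega>) (cot (l \<omega> / 2)) (q \<omega>) (cot (k \<omega> / 2))" for \<omega>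
  have gen: "generate PSL2C {f \<omega>, g \<omega>} = psl_proj ` range (word (P \<omega>))" if \<omega>: "\<omega> \<in> space M" for \<omega>
  proof -
    interpret two_cyclic "P \<omega>" unfolding P_def by (intro two_cyclic_para_powers range \<omega>)
    show ?thesis using parabolic_with_para[OF f[OF \<omega>]] parabolic_with_para[OF g[OF \<omega>]]
      by (intro generate_eq_words) (simp_all add: P_def para_powers_def)
  qed
  have D: "{\<omega> \<in> space M. discrete_in_PSL2C (generate PSL2C {f \<omega>, g \<omega>})}
      = {\<omega> \<in> space M. discrete_in_PSL2C (psl_proj ` range (word (P \<omega>)))}"
    using gen by auto
  have D_sets: "{\<omega> \<in> space M. discrete_in_PSL2C (psl_proj ` range (word (P \<omega>)))} \<in> sets M"
    unfolding P_def cot_def by (intro measurable_discreteness range) measurable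
  have joint: "distr M ((borel \<Otimes>\<^sub>M borel) \<Otimes>\<^sub>M (borel \<Otimes>\<^sub>M borel)) (\<lambda>\<omega>. ((p \<omega>, l \<omega>), (q \<omega>, k \<omega>)))
      = (uniform_circle \<Otimes>\<^sub>M ?V) \<Otimes>\<^sub>M (uniform_circle \<Otimes>\<^sub>M ?V)"
    using assms(4) unfolding indep_var_distribution_eq
    by (simp add: random_parabolic_joint[OF assms(1,2)] random_parabolic_joint[OF assms(1,3)])
  have "1 / 6 \<le> emeasure ((uniform_circle \<Otimes>\<^sub>M ?V) \<Otimes>\<^sub>M (uniform_circle \<Otimes>\<^sub>M ?V)) arcs_apart"
    by (rule emeasure_disjoint_arcs)
  also have "\<dots> = emeasure M {\<omega> \<in> space M. ((p \<omega>, l \<omega>), (q \<omega>, k \<omega>)) \<in> arcs_apart}"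
  proof -
    have "arcs_apart \<in> sets ((borel \<Otimes>\<^sub>M borel) \<Otimes>\<^sub>M (borel \<Otimes>\<^sub>M borel))"
      by (rule sets_disjoint_arcs)
    then show ?thesis unfolding joint[symmetric]
      by (subst emeasure_distr) (auto intro!: arg_cong[where f = "emeasure M"])
  qed
  also have "\<dots> \<le> emeasure M {\<omega> \<in> space M. discrete_in_PSL2C (psl_proj ` range (word (P \<omega>)))}"
    unfolding P_def using range
    by (intro emeasure_mono D_sets[unfolded P_def]) (auto intro!: discrete_of_disjoint_arcs)
  finally have "ennreal (1 / 6) \<le> ennreal (measure M {\<omega> \<in> space M. discrete_in_PSL2C (psl_proj ` range (word (P \<omega>)))})"
    using divide_ennreal[of 1 6] by (simp add: emeasure_eq_measure)
  then show ?thesis unfolding D by simp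
qed

end
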